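(* Let $n,k,m,r$ be positive integers with $r\le k\le m$. (i) If $n\geq \left\lfloor\frac{k-1}{r}\right\rfloor{m\choose k-1}$, then $N(n,k,m;r)=kn-\left\lfloor\frac{k-1}{r}\right\rfloor{m\choose k-1}$. (ii) $N(n,k,m;k)=kn$, and $N(n,k,m;k-1)=kn-{m\choose k-1}$ if $n\geq {m\choose k-1}$, while $N(n,k,m;k-1)=(k-1)n$ if $n< {m\choose k-1}$. (iii) If $r\leq k-2$ and $\left\lfloor\frac{k-1}{r}\right\rfloor{m\choose k-1}-(m-k+1)A(m,4,k-2)\leq n\leq \left\lfloor\frac{k-1}{r}\right\rfloor{m\choose k-1}$, then $N(n,k,m;r)=(k-1)n-\left\lfloor\frac{\left\lfloor\frac{k-1}{r}\right\rfloor{m\choose k-1}-n}{m-k+1}\right\rfloor$. (iv) $N(n,k,k;r)=kn-\left\lfloor\frac{k-1}{r}\right\rfloor k$ provided either $r\mid k$ and $n\geq \frac{k}{r}$, or $r\nmid k$ and $n\geq \lfloor\frac{k}{r}\rfloor+r$. (v) For any prime power $q$, $N(q^2+q,k,q^2;r)\leq q^3+q^2$ whenever either $\lfloor\frac{q}{2}\rfloor+1\leq r\leq q$ and $k\leq (q-r+1)(2r-1)$, or $r=1$ and $k\leq q^2$. Moreover, when $(k,r)\in\{(q^2,1),(2q-1,q)\}$, $N(q^2+q,k,q^2;r)=q^3+q^2$.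
   Context: An $(n,N,k,m;r)$ multiset combinatorial batch code (MCBC) is a collection $\mathcal C=\{C_1,\dots,C_m\}$ of subsets of $[n]=\{1,\dots,n\}$ (servers) with $N=\sum_{j=1}^m|C_j|$, such that for every multiset request $\{i_1,\dots,i_k\}$ of $k$ elements of $[n]$ in which every element has multiplicity at most $r$, there exist subsets $D_j\subseteq C_j$ with $|D_j|\le 1$ ($j\in[m]$) whose multiset union (the multiplicity of $i$ being $|\{j: i\in D_j\}|$) contains the request. $N(n,k,m;r)$ denotes the smallest $N$ for which an $(n,N,k,m;r)$-MCBC exists. $A(m,d,w)$ denotes the maximum number of codewords of a binary constant weight code of length $m$, weight $w$ and minimum Hamming distance $d$.
   Formalization: In the last claim of (ii), N(n,k,m;k-1)=(k-1)n is stated for 1<n<C(m,k-1); for n=1 it is false, since no request of k elements with multiplicity at most k-1 exists on one element, so N(1,k,m;k-1)=0. *)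

theory Defs
  imports "HOL-Number_Theory.Prime_Powers" "HOL-Library.Multiset"
begin

text \<open>
  Servers are a family indexed by \<open>1..m\<close>, so equal servers are allowed. The multiset union of
  the retrieved sets adds multiplicities; it is the sum of the \<^term>\<open>mset_set (D j)\<close>, and not
  the pointwise maximum \<open>\<union>#\<close>.
\<close>

definition is_mcbc :: "nat \<Rightarrow> nat \<Rightarrow> nat \<Rightarrow> nat \<Rightarrow> nat \<Rightarrow> (nat \<Rightarrow> nat set) \<Rightarrow> bool" where
  "is_mcbc n N k m r C \<longleftrightarrow>
     (\<forall>j\<in>{1..m}. C j \<subseteq> {1..n}) \<and>
     N = (\<Sum>j\<in>{1..m}. card (C j)) \<and>
     (\<forall>R :: nat multiset.
        size R = k \<and> set_mset R \<subseteq> {1..n} \<and> (\<forall>i. count R i \<le> r) \<longrightarrow>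
        (\<exists>D :: nat \<Rightarrow> nat set.
           (\<forall>j\<in>{1..m}. D j \<subseteq> C j \<and> card (D j) \<le> 1) \<and>
           R \<subseteq># (\<Sum>j\<in>{1..m}. mset_set (D j))))"

text \<open>
  For \<open>k \<le> m\<close> the minimum is over a nonempty set: storing all of \<open>1..n\<close> on every server works.
\<close>

definition mcbc_min :: "nat \<Rightarrow> nat \<Rightarrow> nat \<Rightarrow> nat \<Rightarrow> nat" where
  "mcbc_min n k m r = (LEAST N. \<exists>C. is_mcbc n N k m r C)"

text \<open>
  If \<open>n * r < k\<close> there is no request at all and the requirement is vacuous. In particular
  \<^term>\<open>mcbc_min 1 k m (k - 1) = 0\<close> for \<open>k \<ge> 2\<close>.
\<close>

lemma mcbc_min_no_request:
  assumes "n * r < k"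
  shows "mcbc_min n k m r = 0"
proof -
  have False if R: "size R = k" "set_mset R \<subseteq> {1..n}" "\<forall>i. count R i \<le> r" for R :: "nat multiset"
  proof -
    have "size R = (\<Sum>i\<in>set_mset R. count R i)"
      by (simp add: size_multiset_overloaded_eq)
    also have "\<dots> \<le> card (set_mset R) * r"
      using R(3) sum_bounded_above[of "set_mset R" "count R" r] by simp
    also have "\<dots> \<le> n * r"
      using card_mono[OF _ R(2)] by simp
    finally show False
      using assms R(1) by simp
  qed
  then have "is_mcbc n 0 k m r (\<lambda>_. {})"
    unfolding is_mcbc_def by auto
  then show ?thesis
    unfolding mcbc_min_def by (metis (mono_tags, lifting) Least_eq_0)
qed

definition hamming_dist :: "bool list \<Rightarrow> bool list \<Rightarrow> nat" where
  "hamming_dist x y = card {i. i < length x \<and> x ! i \<noteq> y ! i}"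

definition constant_weight_code :: "nat \<Rightarrow> nat \<Rightarrow> nat \<Rightarrow> bool list set \<Rightarrow> bool" where
  "constant_weight_code m d w S \<longleftrightarrow>
     (\<forall>x\<in>S. length x = m \<and> count_list x True = w) \<and>
     (\<forall>x\<in>S. \<forall>y\<in>S. x \<noteq> y \<longrightarrow> d \<le> hamming_dist x y)"

text \<open>
  As usual for this function, minimum distance \<open>d\<close> means that distinct codewords are at distance
  at least \<open>d\<close>; codes with fewer than two words qualify.
\<close>

definition max_constant_weight_code :: "nat \<Rightarrow> nat \<Rightarrow> nat \<Rightarrow> nat" where
  "max_constant_weight_code m d w = Max {card S |S. constant_weight_code m d w S}"

end

theory Submission
  imports Defs "HOL-Number_Theory.Residues" "HOL-Algebra.Algebraic_Closure"
begin

text \<open>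
  Pass to the dual family: item \<open>i\<close> is stored on the server set \<open>S i\<close>. By Hall's theorem a request
  scheme exists iff every server set \<open>T\<close> with fewer than \<open>k\<close> elements satisfies
  \<open>r * card {i. S i \<subseteq> T} \<le> card T\<close>. Double counting the pairs \<open>S i \<subseteq> T\<close> with
  \<open>card T = k - 1\<close>, where a set of size \<open>s < k\<close> lies in \<open>(m - s) choose (k - 1 - s)\<close> such \<open>T\<close>,
  gives the lower bounds. They are attained by taking code words of weight \<open>k - 2\<close>, filling up with
  \<open>(k - 1)\<close>-sets and padding with \<open>k\<close>-sets. For \<open>m = k\<close> one uses a partition into
  blocks of size \<open>r\<close> together with complements of transversals of the blocks. For part (v) the items
  are the lines of the affine plane over the field with \<open>q\<close> elements, which is found as the set of
  roots of \<open>X^q - X\<close> in an algebraic closure of the prime field.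
\<close>

subsection \<open>Finite fields\<close>

text \<open>The number of \<open>(k - 1)\<close>-sets above a set of size \<open>s\<close> is convex
  in \<open>s\<close>, and two of its secants yield the bounds: the one through the sizes
  \<open>k - 1\<close> and \<open>k\<close> serves large \<open>n\<close>, the one through
  \<open>k - 2\<close> and \<open>k - 1\<close> the middle range. A secant is exact only at the
  sizes where it meets the curve, and this dictates which layers a good family consists of. Every
  set of size \<open>k - 1\<close> should then be as full as the condition permits; distance 4 keeps
  two code words from sharing such a superset. The obstacle is vacuity. Hall's condition is
  necessary only if an offending \<open>T\<close> can be turned into a request of exactly
  \<open>k\<close> copies, and this requires \<open>k <= n * r\<close>. So each lower bound carries
  this hypothesis, and each exact value has to derive it from its own range of
  \<open>n\<close>.\<close>

lemma (in cring) binomial_theorem: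
  assumes a: "a \<in> carrier R" and b: "b \<in> carrier R"
  shows "(a \<oplus> b) [^] n = (\<Oplus>i\<in>{..n}. [(n choose i)] \<cdot> (a [^] i \<otimes> b [^] (n - i)))"
proof (induction n)
  case 0
  then show ?case using a b by simp
next
  case (Suc n)
  define f where "f i = a [^] i \<otimes> b [^] (Suc n - i)" for i
  have fc: "f i \<in> carrier R" for i using a b by (simp add: f_def)
  have fa: "a [^] i \<otimes> b [^] (n - i) \<otimes> a = f (Suc i)" for i
    using a b by (simp add: f_def m_ac)
  have fb: "a [^] i \<otimes> b [^] (n - i) \<otimes> b = f i" if "i \<le> n" for i
    using a b that by (simp add: f_def m_assoc Suc_diff_le)
  have s: "(\<Oplus>i\<in>{..n}. [(n choose i)] \<cdot> (a [^] i \<otimes> b [^] (n - i))) \<otimes> a = (\<Oplus>i\<in>{..n}. [(n choose i)] \<cdot> f (Suc i))"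
    using a b fc by (subst finsum_ldistr) (auto simp: add_pow_ldistr fa intro!: finsum_cong')
  have t: "(\<Oplus>i\<in>{..n}. [(n choose i)] \<cdot> (a [^] i \<otimes> b [^] (n - i))) \<otimes> b = (\<Oplus>i\<in>{..n}. [(n choose i)] \<cdot> f i)"
    using a b fc by (subst finsum_ldistr) (auto simp: add_pow_ldistr fb intro!: finsum_cong')
  \<comment> \<open>The added index \<open>Suc n\<close> has coefficient zero; it lets index 0 be
    peeled off, so that both sums run over \<open>f (Suc i)\<close> and Pascal's rule applies
    termwise.\<close>
  have "(\<Oplus>i\<in>{..n}. [(n choose i)] \<cdot> f i) = (\<Oplus>i\<in>{..Suc n}. [(n choose i)] \<cdot> f i)"
    using fc by (simp add: Pi_def binomial_eq_0)
  also have "\<dots> = (\<Oplus>i\<in>{..n}. [(n choose Suc i)] \<cdot> f (Suc i)) \<oplus> f 0"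
    using fc by (subst finsum_Suc2) (auto simp: Pi_def)
  finally have t': "(\<Oplus>i\<in>{..n}. [(n choose i)] \<cdot> f i) = (\<Oplus>i\<in>{..n}. [(n choose Suc i)] \<cdot> f (Suc i)) \<oplus> f 0" .
  have "(a \<oplus> b) [^] Suc n = (\<Oplus>i\<in>{..n}. [(n choose i)] \<cdot> f (Suc i)) \<oplus> ((\<Oplus>i\<in>{..n}. [(n choose Suc i)] \<cdot> f (Suc i)) \<oplus> f 0)"
    using a b Suc.IH s t t' by (simp add: r_distr)
  also have "\<dots> = (\<Oplus>i\<in>{..n}. [(n choose i)] \<cdot> f (Suc i) \<oplus> [(n choose Suc i)] \<cdot> f (Suc i)) \<oplus> f 0"
    using fc by (simp add: finsum_addf Pi_def a_assoc)
  also have "\<dots> = (\<Oplus>i\<in>{..n}. [(Suc n choose Suc i)] \<cdot> f (Suc i)) \<oplus> f 0"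
    using fc by (simp add: add.nat_pow_mult)
  also have "\<dots> = (\<Oplus>i\<in>{..Suc n}. [(Suc n choose i)] \<cdot> f i)"
    using fc by (subst finsum_Suc2) (auto simp: Pi_def)
  finally show ?case by (simp add: f_def)
qed

lemma (in cring) add_pow_eq_zero:
  assumes "[p] \<cdot> \<one> = \<zero>" "p dvd (n::nat)" "x \<in> carrier R"
  shows "[n] \<cdot> x = \<zero>"
proof -
  obtain k where n: "n = p * k" using assms(2) by blast
  have "[p] \<cdot> x = \<zero>"
    using add_pow_ldistr[of \<one> x p] assms by simp
  then show ?thesis
    using assms(3) add.nat_pow_pow[of x p k] add.nat_pow_pow[of x k p] by (simp add: n mult.commute)
qed

text \<open>For \<open>0 < i < p\<close> the prime \<open>p\<close> divides
  \<open>p choose i\<close>, so only the two end terms survive; iteration gives the exponent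
  \<open>p ^ e\<close>. It is placed in commutative rings because it is applied to polynomials as
  well as to field elements.\<close>

lemma (in cring) freshmans_dream:
  assumes p: "Factorial_Ring.prime (p::nat)" and char: "[p] \<cdot> \<one> = \<zero>"
    and a: "a \<in> carrier R" and b: "b \<in> carrier R"
  shows "(a \<oplus> b) [^] (p ^ e) = a [^] (p ^ e) \<oplus> b [^] (p ^ e)"
proof -
  have step: "(x \<oplus> y) [^] p = x [^] p \<oplus> y [^] p" if x: "x \<in> carrier R" and y: "y \<in> carrier R" for x y
  proof -
    obtain k where k: "p = Suc (Suc k)"
      using prime_ge_2_nat[OF p] that[of "p - 2"] by simp
    define g where "g i = [(p choose i)] \<cdot> (x [^] i \<otimes> y [^] (p - i))" for i
    have gc: "g i \<in> carrier R" for i using x y by (simp add: g_def)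
    have z: "g i = \<zero>" if "0 < i" "i < p" for i
      unfolding g_def using x y that dvd_choose_prime[of i p] p
      by (intro add_pow_eq_zero[OF char]) simp_all
    have g0: "g 0 = y [^] p" "g p = x [^] p" using x y by (simp_all add: g_def)
    have "(x \<oplus> y) [^] p = (\<Oplus>i\<in>{..Suc (Suc k)}. g i)"
      unfolding binomial_theorem[OF x y, of p] g_def by (simp only: k)
    also have "\<dots> = g p \<oplus> (\<Oplus>i\<in>{..Suc k}. g i)"
      using gc by (subst finsum_Suc) (simp_all add: k)
    also have "(\<Oplus>i\<in>{..Suc k}. g i) = (\<Oplus>i\<in>{..k}. g (Suc i)) \<oplus> g 0"
      using gc by (subst finsum_Suc2) simp_all
    also have "(\<Oplus>i\<in>{..k}. g (Suc i)) = (\<Oplus>i\<in>{..k}. \<zero>)"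
      using z by (intro finsum_cong') (auto simp: k)
    also have "\<dots> = \<zero>" by simp
    finally have "(x \<oplus> y) [^] p = x [^] p \<oplus> (\<zero> \<oplus> y [^] p)"
      unfolding g0 .
    then show ?thesis using x y by simp
  qed
  show ?thesis
  proof (induction e)
    case (Suc e)
    have "(a \<oplus> b) [^] (p ^ Suc e) = ((a \<oplus> b) [^] (p ^ e)) [^] p"
      using a b by (simp add: nat_pow_pow mult.commute)
    also have "\<dots> = a [^] (p ^ Suc e) \<oplus> b [^] (p ^ Suc e)"
      using a b by (simp add: Suc.IH step nat_pow_pow mult.commute)
    finally show ?case .
  qed (use a b in simp)
qed

lemma ring_hom_add_pow:
  fixes n :: nat
  assumes "ring_hom_ring R S h" "x \<in> carrier R"
  shows "h ([n] \<cdot>\<^bsub>R\<^esub> x) = [n] \<cdot>\<^bsub>S\<^esub> h x"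
proof -
  interpret ring_hom_ring R S h by fact
  show ?thesis
    using assms(2) by (induction n) simp_all
qed

text \<open>\<open>X^q - X\<close> splits, so it has \<open>q\<close> roots counted with
  multiplicity, and the point is that each of them is simple. The polynomial ring inherits
  characteristic \<open>p\<close>, hence Frobenius can take the place of a derivative.\<close>

lemma (in algebraically_closed) card_frobenius_fixed:
  assumes p: "Factorial_Ring.prime (p::nat)" and char: "[p] \<cdot> \<one> = \<zero>" and e: "e > 0"
  shows "card {x \<in> carrier L. x [^] (p ^ e) = x} = p ^ e"
proof -
  define q where "q = p ^ e"
  have q2: "q \<ge> 2"
    using prime_ge_2_nat[OF p] e by (metis q_def dvd_imp_le dvd_power order_trans p prime_gt_0_nat zero_less_power)
  let ?P = "poly_ring L"
  interpret P: domain ?P using univ_poly_is_domain[OF carrier_is_subring] .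
  have X: "X \<in> carrier ?P" using var_closed(1)[OF carrier_is_subring] .
  define F where "F = X [^]\<^bsub>?P\<^esub> q \<ominus>\<^bsub>?P\<^esub> X"
  have F: "F \<in> carrier ?P" using X by (simp add: F_def)
  have ev: "eval F x = x [^] q \<ominus> x" if x: "x \<in> carrier L" for x
  proof -
    interpret h: ring_hom_cring ?P L "\<lambda>p. eval p x"
      using eval_cring_hom[OF carrier_is_subring x] .
    show ?thesis
      using X x by (simp add: F_def a_minus_def P.minus_eq eval_var)
  qed
  have dX: "degree X = 1" by (simp add: var_def)
  have dXq: "degree (X [^]\<^bsub>?P\<^esub> q) = q"
    using polynomial_pow_degree[OF X, of q] dX by simp
  have dF: "degree F = q"
  proof -
    have "degree (\<ominus>\<^bsub>?P\<^esub> X) = 1"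
      using univ_poly_a_inv_degree[OF carrier_is_subring X] dX by simp
    moreover have "polynomial (carrier L) (X [^]\<^bsub>?P\<^esub> q)" "polynomial (carrier L) (\<ominus>\<^bsub>?P\<^esub> X)"
      using X by (auto simp: univ_poly_carrier)
    ultimately show ?thesis
      using poly_add_degree_eq[OF carrier_is_subring, of "X [^]\<^bsub>?P\<^esub> q" "\<ominus>\<^bsub>?P\<^esub> X"] dXq q2
      by (simp add: F_def a_minus_def univ_poly_add)
  qed
  have root: "x \<in># roots F \<longleftrightarrow> x \<in> carrier L \<and> x [^] q = x" for x
  proof -
    have "F \<noteq> []" using dF q2 by auto
    then show ?thesis
      unfolding roots_mem_iff_is_root[OF F] is_root_def
      by (cases "x \<in> carrier L") (simp_all add: ev)
  qed
  interpret C: ring_hom_ring L ?P poly_of_const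
    using canonical_embedding_ring_hom[OF carrier_is_subring] by simp
  have charP: "[p] \<cdot>\<^bsub>?P\<^esub> \<one>\<^bsub>?P\<^esub> = \<zero>\<^bsub>?P\<^esub>"
    using ring_hom_add_pow[OF C.ring_hom_ring_axioms, of \<one> p] char by simp
  have simple: "count (roots F) a \<le> 1" if a: "a \<in> carrier L" "a [^] q = a" for a
  proof (rule ccontr)
    assume "\<not> count (roots F) a \<le> 1"
    then have 2: "2 \<le> alg_mult F a"
      using alg_mult_eq_count_roots[OF F] by simp
    define D where "D = [\<one>, \<ominus> a]"
    define A where "A = poly_of_const a"
    have D: "D \<in> carrier ?P"
      using a by (simp add: D_def univ_poly_carrier[symmetric] polynomial_def)
    have A: "A \<in> carrier ?P" using a by (simp add: A_def)
    \<comment> \<open>By the Frobenius identity \<open>X^q - X = D^q - D\<close>, so a double root would make \<open>D^2\<close> divide \<open>D\<close>.\<close>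
    have XDA: "X = D \<oplus>\<^bsub>?P\<^esub> A"
      using a by (auto simp: D_def A_def poly_of_const_def var_def univ_poly_add l_neg)
    have "X [^]\<^bsub>?P\<^esub> q = D [^]\<^bsub>?P\<^esub> q \<oplus>\<^bsub>?P\<^esub> A"
      using P.freshmans_dream[OF p charP D A, of e] C.hom_nat_pow[OF a(1), of q] a(2)
      by (simp add: XDA q_def A_def)
    then have FD: "F = D [^]\<^bsub>?P\<^esub> q \<ominus>\<^bsub>?P\<^esub> D"
      using D A unfolding F_def XDA
      by (simp add: a_minus_def P.minus_eq P.minus_add P.a_ac P.r_neg1 P.r_neg2)
    have "D [^]\<^bsub>?P\<^esub> (2::nat) pdivides F"
      using le_alg_mult_imp_pdivides[OF a(1) F 2] by (simp add: D_def)
    then obtain h where h: "h \<in> carrier ?P" "F = D [^]\<^bsub>?P\<^esub> (2::nat) \<otimes>\<^bsub>?P\<^esub> h"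
      unfolding pdivides_def factor_def by auto
    have "D = D [^]\<^bsub>?P\<^esub> q \<ominus>\<^bsub>?P\<^esub> F"
      using D unfolding FD by (simp add: a_minus_def P.minus_add P.r_neg2)
    also have "D [^]\<^bsub>?P\<^esub> q = D [^]\<^bsub>?P\<^esub> (2::nat) \<otimes>\<^bsub>?P\<^esub> D [^]\<^bsub>?P\<^esub> (q - 2)"
      using P.nat_pow_mult[OF D, of 2 "q - 2"] q2 by (metis le_add_diff_inverse)
    finally have "D = D [^]\<^bsub>?P\<^esub> (2::nat) \<otimes>\<^bsub>?P\<^esub> (D [^]\<^bsub>?P\<^esub> (q - 2) \<ominus>\<^bsub>?P\<^esub> h)"
      using D h by (simp add: a_minus_def P.minus_eq P.r_distr P.r_minus)
    then have "D [^]\<^bsub>?P\<^esub> (2::nat) pdivides D"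
      unfolding pdivides_def using D h by (metis P.minus_closed P.nat_pow_closed dividesI)
    moreover have "degree (D [^]\<^bsub>?P\<^esub> (2::nat)) = 2"
      using polynomial_pow_degree[OF D, of 2] by (simp add: D_def)
    ultimately show False
      using pdivides_imp_degree_le[OF carrier_is_subring _ D, of "D [^]\<^bsub>?P\<^esub> (2::nat)"] D
      by (simp add: D_def)
  qed
  have "q = size (roots F)"
    using roots_over_carrier[OF F] dF by (simp add: splitted_def)
  also have "\<dots> = (\<Sum>x\<in>set_mset (roots F). count (roots F) x)"
    by (simp add: size_multiset_overloaded_eq)
  also have "\<dots> = (\<Sum>x\<in>set_mset (roots F). 1)"
    using simple root by (intro sum.cong) (auto simp: le_antisym Suc_le_eq)
  also have "\<dots> = card {x \<in> carrier L. x [^] q = x}"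
  proof -
    have "set_mset (roots F) = {x \<in> carrier L. x [^] q = x}" using root by blast
    then show ?thesis by simp
  qed
  finally show ?thesis by (simp add: q_def)
qed

text \<open>The fixed points of \<open>x -> x^q\<close> are closed under sums by Frobenius and under
  products by commutativity. The plane only evaluates \<open>s x + y\<close>, so these two closures
  are exported, and cancellation is left to the surrounding field \<open>L\<close>.\<close>

lemma exists_field_subset_card:
  assumes "primepow q"
  obtains L :: "((int list \<times> nat) multiset \<Rightarrow> int) ring" and K where "field L" "K \<subseteq> carrier L" "card K = q"
    "\<And>x y. x \<in> K \<Longrightarrow> y \<in> K \<Longrightarrow> x \<oplus>\<^bsub>L\<^esub> y \<in> K" "\<And>x y. x \<in> K \<Longrightarrow> y \<in> K \<Longrightarrow> x \<otimes>\<^bsub>L\<^esub> y \<in> K"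
proof -
  obtain p e where p: "Factorial_Ring.prime p" and e: "e > 0" and q: "q = p ^ e"
    using assms by (auto simp: primepow_def)
  let ?R = "residue_ring (int p)"
  interpret R: residues_prime p ?R
    using p by unfold_locales simp_all
  let ?L = "field.alg_closure ?R"
  let ?h = "ring.indexed_const ?R"
  interpret L: algebraic_closure ?L "?h ` carrier ?R"
    by (rule R.alg_closureE)
  interpret h: ring_hom_ring ?R ?L ?h
    by (rule ring_hom_ringI2[OF R.ring_axioms L.ring_axioms R.alg_closureE(2)])
  have "[k] \<cdot>\<^bsub>?R\<^esub> \<one>\<^bsub>?R\<^esub> = int k mod int p" for k
    using prime_ge_2_nat[OF p]
    by (induction k) (simp_all add: R.res_one_eq R.res_add_eq R.res_zero_eq mod_simps add.commute)
  then have "[p] \<cdot>\<^bsub>?R\<^esub> \<one>\<^bsub>?R\<^esub> = \<zero>\<^bsub>?R\<^esub>"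
    by (simp add: R.res_zero_eq)
  then have char: "[p] \<cdot>\<^bsub>?L\<^esub> \<one>\<^bsub>?L\<^esub> = \<zero>\<^bsub>?L\<^esub>"
    using ring_hom_add_pow[OF h.ring_hom_ring_axioms, of "\<one>\<^bsub>?R\<^esub>" p] by simp
  show ?thesis
  proof (rule that[of ?L "{x \<in> carrier ?L. x [^]\<^bsub>?L\<^esub> (p ^ e) = x}"])
    show "card {x \<in> carrier ?L. x [^]\<^bsub>?L\<^esub> (p ^ e) = x} = q"
      using L.card_frobenius_fixed[OF p char e] q by simp
  qed (use L.field_axioms L.freshmans_dream[OF p char] in \<open>auto simp: L.nat_pow_distrib\<close>)
qed

text \<open>Otherwise \<open>X\<close> is a token and cannot be used as a variable.\<close>

no_notation var (\<open>X\<index>\<close>)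

subsection \<open>Hall's theorem and the dual condition\<close>

text \<open>The argument of Halmos and Vaughan. A nonempty proper subfamily whose union is exactly
  as large as the subfamily is served first, and Hall's condition survives for the rest outside that
  union. If there is none, every nonempty proper subfamily has an element to spare.\<close>

lemma hall_sdr:
  fixes A :: "'a \<Rightarrow> 'b set"
  assumes "finite J" "\<And>j. j \<in> J \<Longrightarrow> finite (A j)"
    and "\<And>I. I \<subseteq> J \<Longrightarrow> card I \<le> card (\<Union>(A ` I))"
  obtains f where "inj_on f J" "\<And>j. j \<in> J \<Longrightarrow> f j \<in> A j"
proof -
  have "\<exists>f. inj_on f J \<and> (\<forall>j\<in>J. f j \<in> A j)"
    using assms
  proof (induction "card J" arbitrary: J A rule: less_induct)
    case less
    note fin = less.prems(1) and finA = less.prems(2) and hall = less.prems(3)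
    show ?case
    proof (cases "J = {}")
      case False
      show ?thesis
      proof (cases "\<exists>I. I \<noteq> {} \<and> I \<subset> J \<and> card (\<Union>(A ` I)) = card I")
        case True
        then obtain I where I: "I \<noteq> {}" "I \<subset> J" "card (\<Union>(A ` I)) = card I" by blast
        let ?U = "\<Union>(A ` I)"
        have finI: "finite I" using I fin by (meson finite_subset psubset_imp_subset)
        have finU: "finite ?U" using I finA finI by blast
        have "card I < card J" using I fin by (simp add: psubset_card_mono)
        moreover have "finite (A j)" if "j \<in> I" for j using that I finA by blast
        moreover have "card K \<le> card (\<Union>(A ` K))" if "K \<subseteq> I" for K using that I hall by blast
        ultimately obtain f where f: "inj_on f I" "\<forall>j\<in>I. f j \<in> A j"
          using less.hyps[of I A] finI by blast
        have "card (J - I) < card J"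
          using I fin finI by (metis card_Diff_subset card_gt_0_iff diff_less psubset_imp_subset card_mono
              less_le_trans)
        moreover have "card K \<le> card (\<Union>((\<lambda>j. A j - ?U) ` K))" if K: "K \<subseteq> J - I" for K
        proof -
          have finK: "finite K" using K fin by (meson finite_Diff finite_subset)
          have "card K + card I = card (K \<union> I)"
            using K finK finI by (subst card_Un_disjoint) auto
          also have "\<dots> \<le> card (\<Union>(A ` (K \<union> I)))"
            using K I by (intro hall) blast
          also have "\<Union>(A ` (K \<union> I)) = \<Union>((\<lambda>j. A j - ?U) ` K) \<union> ?U" by blast
          also have "card \<dots> \<le> card (\<Union>((\<lambda>j. A j - ?U) ` K)) + card ?U" by (rule card_Un_le)
          finally show ?thesis using I(3) by simp
        qed
        ultimately obtain g where g: "inj_on g (J - I)" "\<forall>j\<in>J - I. g j \<in> A j - ?U"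
          using less.hyps[of "J - I" "\<lambda>j. A j - ?U"] fin finA by blast
        let ?h = "\<lambda>j. if j \<in> I then f j else g j"
        have neq: "f x \<noteq> g y" if "x \<in> I" "y \<in> J - I" for x y
          using f(2) g(2) that by fastforce
        have "inj_on ?h J"
        proof (rule inj_onI)
          fix x y assume "x \<in> J" "y \<in> J" "?h x = ?h y"
          then show "x = y"
            using f(1) g(1) neq by (cases "x \<in> I"; cases "y \<in> I") (fastforce dest: inj_onD)+
        qed
        moreover have "\<forall>j\<in>J. ?h j \<in> A j" using f g by auto
        ultimately show ?thesis by blast
      next
        case no: False
        obtain j where j: "j \<in> J" using False by blast
        have "card {j} \<le> card (\<Union>(A ` {j}))" using j by (intro hall) auto
        then obtain a where a: "a \<in> A j" by (cases "A j = {}") auto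
        have "card (J - {j}) < card J" using j fin by (meson card_Diff1_less)
        moreover have "card K \<le> card (\<Union>((\<lambda>j. A j - {a}) ` K))" if K: "K \<subseteq> J - {j}" for K
        proof (cases "K = {}")
          case False
          \<comment> \<open>Strict inequality in Hall's condition for \<open>K\<close> pays for the
            removal of \<open>a\<close>.\<close>
          have "card K \<noteq> card (\<Union>(A ` K))" using no False K j by (metis Diff_subset Diff_iff insertI1 psubsetI subset_iff)
          then have "card K < card (\<Union>(A ` K))" using hall[of K] K by force
          moreover have "(\<Union>j\<in>K. A j - {a}) = \<Union>(A ` K) - {a}" by blast
          moreover have "card (\<Union>(A ` K)) - 1 \<le> card (\<Union>(A ` K) - {a})" by (simp add: card_Diff_singleton_if)
          ultimately show ?thesis by simp
        qed simp
        ultimately obtain f where f: "inj_on f (J - {j})" "\<forall>i\<in>J - {j}. f i \<in> A i - {a}"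
          using less.hyps[of "J - {j}" "\<lambda>j. A j - {a}"] fin finA by blast
        have "inj_on (f(j := a)) J"
        proof (rule inj_onI)
          fix x y assume "x \<in> J" "y \<in> J" "(f(j := a)) x = (f(j := a)) y"
          then show "x = y"
            using f by (cases "x = j"; cases "y = j") (auto dest: inj_onD)
        qed
        moreover have "\<forall>i\<in>J. (f(j := a)) i \<in> A i" using f a by auto
        ultimately show ?thesis by blast
      qed
    qed simp
  qed
  then show ?thesis using that by blast
qed

text \<open>Larger \<open>T\<close> need no test, since a request has only \<open>k\<close> copies
  to place. Items are indices, so several may share a server set. The types are free because items
  will also be lines, or pairs of a set and a copy number.\<close>

definition sparse :: "nat \<Rightarrow> nat \<Rightarrow> 'b set \<Rightarrow> 'a set \<Rightarrow> ('a \<Rightarrow> 'b set) \<Rightarrow> bool" where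
  "sparse k r P V S \<longleftrightarrow> (\<forall>v\<in>V. S v \<subseteq> P) \<and>
     (\<forall>T\<subseteq>P. card T < k \<longrightarrow> r * card {v \<in> V. S v \<subseteq> T} \<le> card T)"

text \<open>Hall's theorem is applied to the copies of the requested items, the candidates of a copy
  being the servers that hold its item. Injectivity then says that no server delivers twice.\<close>

lemma sparse_imp_mcbc:
  assumes S: "sparse k r {1..m} {1..n} S"
  shows "is_mcbc n (\<Sum>i\<in>{1..n}. card (S i)) k m r (\<lambda>j. {i \<in> {1..n}. j \<in> S i})"
  unfolding is_mcbc_def
proof (intro conjI allI impI ballI)
  have Sm: "S i \<subseteq> {1..m}" if "i \<in> {1..n}" for i using S that by (auto simp: sparse_def)
  show "(\<Sum>i = 1..n. card (S i)) = (\<Sum>j = 1..m. card {i \<in> {1..n}. j \<in> S i})"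
  proof -
    have "(\<Sum>i = 1..n. card (S i)) = (\<Sum>i = 1..n. card {j \<in> {1..m}. j \<in> S i})"
      using Sm by (intro sum.cong refl arg_cong[where f = card]) blast
    also have "\<dots> = (\<Sum>j = 1..m. card {i \<in> {1..n}. j \<in> S i})"
      by (rule sum_multicount_gen) auto
    finally show ?thesis .
  qed
  fix R :: "nat multiset"
  assume R: "size R = k \<and> set_mset R \<subseteq> {1..n} \<and> (\<forall>i. count R i \<le> r)"
  \<comment> \<open>A copy of item \<open>i\<close> is a pair \<open>(i, c)\<close>. There are
    \<open>k\<close> of them, which settles Hall's condition as soon as the union of the candidates
    has \<open>k\<close> elements.\<close>
  define J where "J = (SIGMA i:set_mset R. {..<count R i})"
  have mem_J: "(i, c) \<in> J \<longleftrightarrow> c < count R i" for i c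
    by (auto simp: J_def intro: count_inI)
  have finJ: "finite J" by (simp add: J_def)
  have cardJ: "card J = k"
    using R by (simp add: J_def size_multiset_overloaded_eq)
  have J1: "fst x \<in> {1..n}" "snd x < r" if x: "x \<in> J" for x
  proof -
    have "fst x \<in> set_mset R" "snd x < count R (fst x)" using x by (auto simp: J_def)
    then show "fst x \<in> {1..n}" "snd x < r" using R by (blast, meson less_le_trans)
  qed
  have hall: "card I \<le> card (\<Union>((S \<circ> fst) ` I))" if I: "I \<subseteq> J" for I
  proof -
    define T where "T = \<Union>((S \<circ> fst) ` I)"
    have T: "T \<subseteq> {1..m}" unfolding T_def using Sm J1(1) I by (intro UN_least) (metis comp_apply subsetD)
    show ?thesis
    proof (cases "card T < k")
      case False
      then show ?thesis using card_mono[OF finJ I] cardJ by (simp add: T_def)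
    next
      case True
      have "x \<in> {v \<in> {1..n}. S v \<subseteq> T} \<times> {..<r}" if "x \<in> I" for x
        using J1[of x] I that by (cases x) (auto simp: T_def)
      then have "I \<subseteq> {v \<in> {1..n}. S v \<subseteq> T} \<times> {..<r}" by blast
      then have "card I \<le> card ({v \<in> {1..n}. S v \<subseteq> T} \<times> {..<r})"
        by (intro card_mono) auto
      also have "\<dots> \<le> card T"
        using S T True by (simp add: sparse_def card_cartesian_product mult.commute)
      finally show ?thesis by (simp add: T_def)
    qed
  qed
  have fin: "finite ((S \<circ> fst) j)" if "j \<in> J" for j
    using Sm[OF J1(1)[OF that]] finite_subset by fastforce
  obtain f where f: "inj_on f J" "\<And>j. j \<in> J \<Longrightarrow> f j \<in> (S \<circ> fst) j"
    using hall_sdr[OF finJ fin hall] by blast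
  define D where "D j = {i. \<exists>c. (i, c) \<in> J \<and> f (i, c) = j}" for j
  show "\<exists>D. (\<forall>j\<in>{1..m}. D j \<subseteq> {i \<in> {1..n}. j \<in> S i} \<and> card (D j) \<le> 1) \<and>
      R \<subseteq># (\<Sum>j = 1..m. mset_set (D j))"
  proof (intro exI[of _ D] conjI ballI)
    fix j assume "j \<in> {1..m}"
    show "D j \<subseteq> {i \<in> {1..n}. j \<in> S i}"
      using f(2) J1(1) by (fastforce simp: D_def)
    have "\<And>x y. x \<in> D j \<Longrightarrow> y \<in> D j \<Longrightarrow> x = y"
      using f(1) by (auto simp: D_def dest: inj_onD)
    then show "card (D j) \<le> 1"
      by (metis card_le_Suc0_iff_eq One_nat_def card.infinite zero_le)
  next
    show "R \<subseteq># (\<Sum>j = 1..m. mset_set (D j))"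
    proof (rule mset_subset_eqI)
      fix i
      have "D j \<subseteq> fst ` J" for j by (auto simp: D_def intro: rev_image_eqI)
      then have Df: "finite (D j)" for j using finJ by (meson finite_imageI finite_subset)
      have "count R i = card ((\<lambda>c. f (i, c)) ` {..<count R i})"
        by (subst card_image) (auto simp: mem_J intro!: inj_onI dest!: inj_onD[OF f(1)])
      also have "\<dots> \<le> card {j \<in> {1..m}. i \<in> D j}"
      proof (rule card_mono)
        show "(\<lambda>c. f (i, c)) ` {..<count R i} \<subseteq> {j \<in> {1..m}. i \<in> D j}"
        proof
          fix x assume "x \<in> (\<lambda>c. f (i, c)) ` {..<count R i}"
          then obtain c where c: "c < count R i" "x = f (i, c)" by blast
          then have J: "(i, c) \<in> J" by (simp add: mem_J)
          then have "i \<in> {1..n}" using J1(1) by force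
          then show "x \<in> {j \<in> {1..m}. i \<in> D j}"
            using f(2)[OF J] Sm[of i] J c unfolding D_def by auto
        qed
      qed auto
      also have "\<dots> = count (\<Sum>j = 1..m. mset_set (D j)) i"
        by (simp add: count_sum count_mset_set' Df sum.If_cases Int_def)
      finally show "count R i \<le> count (\<Sum>j = 1..m. mset_set (D j)) i" .
    qed
  qed
qed auto

lemma submultiset_of_size:
  assumes "X \<subseteq># Y" "size X \<le> k" "k \<le> size Y"
  obtains Z where "X \<subseteq># Z" "Z \<subseteq># Y" "size Z = k"
proof -
  have "\<exists>Z. X \<subseteq># Z \<and> Z \<subseteq># Y \<and> size Z = k"
    using assms(2,3)
  proof (induction k rule: dec_induct)
    case base
    then show ?case using assms(1) by blast
  next
    case (step k)
    then obtain Z where Z: "X \<subseteq># Z" "Z \<subseteq># Y" "size Z = k" by auto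
    then have "Z \<subset># Y" using step by (metis Suc_n_not_le_n subset_mset.le_imp_less_or_eq)
    then obtain a where "a \<in># Y - Z"
      by (metis Diff_eq_empty_iff_mset multiset_nonemptyE subset_mset.less_le_not_le)
    then have "add_mset a Z \<subseteq># Y"
      using Z(2) by (simp add: insert_subset_eq_iff in_diff_count mset_subset_eq_insertD Suc_le_eq subseteq_mset_def)
    then show ?case using Z by (intro exI[of _ "add_mset a Z"]) (auto intro: subset_mset.order_trans)
  qed
  then show ?thesis using that by blast
qed

lemma filter_mset_sum: "filter_mset Q (sum f A) = (\<Sum>x\<in>A. filter_mset Q (f x))"
  by (induction A rule: infinite_finite_induct) auto

text \<open>If \<open>T\<close> violates the condition, some request contains more than
  \<open>card T\<close> copies of items that are stored only inside \<open>T\<close>, and the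
  servers of \<open>T\<close> cannot deliver that many. The bound \<open>k <= n * r\<close> makes it
  possible to pad such a request to size \<open>k\<close>.\<close>

lemma mcbc_imp_sparse:
  assumes C: "is_mcbc n N k m r C" and nr: "k \<le> n * r"
  shows "sparse k r {1..m} {1..n} (\<lambda>i. {j \<in> {1..m}. i \<in> C j})" (is "sparse _ _ _ _ ?S")
    and "N = (\<Sum>i\<in>{1..n}. card {j \<in> {1..m}. i \<in> C j})"
proof -
  show "sparse k r {1..m} {1..n} ?S"
    unfolding sparse_def
  proof (intro conjI allI impI ballI)
    fix T assume T: "T \<subseteq> {1..m}" "card T < k"
    define I where "I = {v \<in> {1..n}. ?S v \<subseteq> T}"
    define X where "X = (\<Sum>i\<in>I. replicate_mset r i)"
    define Y where "Y = (\<Sum>i\<in>{1..n}. replicate_mset r i)"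
    have I: "I \<subseteq> {1..n}" "finite I" by (auto simp: I_def)
    have cnt: "count X i = (if i \<in> I then r else 0)" "count Y i = (if i \<in> {1..n} then r else 0)" for i
      using I by (simp_all add: X_def Y_def count_sum)
    have szX: "size X = r * card I" and szY: "size Y = n * r"
      by (simp_all add: X_def Y_def size_multiset_sum mult.commute)
    have XY: "X \<subseteq># Y"
    proof (rule mset_subset_eqI)
      show "count X a \<le> count Y a" for a
        using subsetD[OF I(1), of a] unfolding cnt by auto
    qed
    have "r * card I \<le> card T"
    proof (rule ccontr)
      assume con: "\<not> r * card I \<le> card T"
      obtain R where R: "R \<subseteq># Y" "size R = k" "card T < size (filter_mset (\<lambda>i. i \<in> I) R)"
      \<comment> \<open>Either all \<open>r\<close> copies of all items of \<open>I\<close> fit into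
        a request, which is then padded inside \<open>Y\<close>, or \<open>k\<close> of these copies
        already form one, and \<open>k\<close> exceeds \<open>card T\<close>.\<close>
      proof (cases "r * card I \<le> k")
        case True
        then obtain R where R: "X \<subseteq># R" "R \<subseteq># Y" "size R = k"
          using submultiset_of_size[OF XY, of k] szX szY nr by auto
        have "filter_mset (\<lambda>i. i \<in> I) X = X"
          by (rule multiset_eqI) (simp add: cnt)
        then have "X \<subseteq># filter_mset (\<lambda>i. i \<in> I) R"
          using multiset_filter_mono[OF R(1)] by metis
        then show ?thesis using that R con szX size_mset_mono by fastforce
      next
        case False
        then obtain R where R: "R \<subseteq># X" "size R = k"
          using submultiset_of_size[of "{#}" X k] szX by auto
        have "\<forall>i. i \<in># R \<longrightarrow> i \<in> I"
          using R(1) by (metis cnt(1) mset_subset_eqD not_in_iff)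
        then have "filter_mset (\<lambda>i. i \<in> I) R = R"
          by (simp add: filter_mset_eq_conv)
        then show ?thesis using that R XY T by (metis subset_mset.order_trans)
      qed
      have "set_mset R \<subseteq> {1..n}" using R(1) by (metis cnt(2) mset_subset_eqD not_in_iff subsetI)
      moreover have "count R i \<le> r" for i
        using mset_subset_eq_count[OF R(1), of i] cnt(2)[of i] by (auto split: if_splits)
      ultimately obtain D where D: "\<forall>j\<in>{1..m}. D j \<subseteq> C j \<and> card (D j) \<le> 1"
          and RD: "R \<subseteq># (\<Sum>j\<in>{1..m}. mset_set (D j))"
        using C R(2) by (auto simp: is_mcbc_def)
      have Df: "finite (D j)" if "j \<in> {1..m}" for j
        using C D that by (meson finite_atLeastAtMost finite_subset is_mcbc_def)
      have "filter_mset (\<lambda>i. i \<in> I) R \<subseteq># filter_mset (\<lambda>i. i \<in> I) (\<Sum>j\<in>{1..m}. mset_set (D j))"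
        by (rule multiset_filter_mono[OF RD])
      also have "\<dots> = (\<Sum>j\<in>{1..m}. filter_mset (\<lambda>i. i \<in> I) (mset_set (D j)))"
        by (simp add: filter_mset_sum)
      also have "\<dots> = (\<Sum>j\<in>{1..m}. mset_set (D j \<inter> I))"
        using Df by (intro sum.cong) (auto simp: filter_mset_mset_set Int_def)
      finally have "size (filter_mset (\<lambda>i. i \<in> I) R) \<le> (\<Sum>j\<in>{1..m}. card (D j \<inter> I))"
        using size_mset_mono by (fastforce simp: size_multiset_sum)
      also have "\<dots> \<le> (\<Sum>j\<in>{1..m}. if j \<in> T then 1 else 0)"
      proof (rule sum_mono)
        fix j assume j: "j \<in> {1..m}"
        show "card (D j \<inter> I) \<le> (if j \<in> T then 1 else 0)"
        proof (cases "j \<in> T")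
          case True
          then show ?thesis using card_mono[OF Df[OF j], of "D j \<inter> I"] D j by force
        next
          case False
          then have "D j \<inter> I = {}" using D j False unfolding I_def by blast
          then show ?thesis by simp
        qed
      qed
      also have "\<dots> = card T"
        using T(1) by (simp add: sum.If_cases Int_absorb1)
      finally show False using R(3) by simp
    qed
    then show "r * card {v \<in> {1..n}. ?S v \<subseteq> T} \<le> card T" by (simp add: I_def)
  qed auto
  have "N = (\<Sum>j\<in>{1..m}. card {i \<in> {1..n}. i \<in> C j})"
  proof -
    have "N = (\<Sum>j\<in>{1..m}. card (C j))" using C by (simp add: is_mcbc_def)
    also have "\<dots> = (\<Sum>j\<in>{1..m}. card {i \<in> {1..n}. i \<in> C j})"
      using C unfolding is_mcbc_def by (intro sum.cong refl arg_cong[where f = card]) blast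
    finally show ?thesis .
  qed
  also have "\<dots> = (\<Sum>i\<in>{1..n}. card {j \<in> {1..m}. i \<in> C j})"
    by (rule sum_multicount_gen[symmetric]) auto
  finally show "N = (\<Sum>i\<in>{1..n}. card {j \<in> {1..m}. i \<in> C j})" .
qed

text \<open>Renaming items and servers does not affect sparseness; this carries constructions on
  arbitrary finite sets over to the intervals of the definition.\<close>

lemma mcbc_min_le:
  assumes "finite V" "finite P" and S: "sparse k r P V S" and n: "card V = n" and m: "card P = m"
  shows "mcbc_min n k m r \<le> (\<Sum>v\<in>V. card (S v))"
proof -
  obtain g where g: "bij_betw g {1..n} V"
    using assms(1) n by (metis card_atLeastAtMost diff_Suc_1 finite_atLeastAtMost finite_same_card_bij)
  obtain h where h: "bij_betw h P {1..m}"
    using assms(2) m by (metis card_atLeastAtMost diff_Suc_1 finite_atLeastAtMost finite_same_card_bij)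
  note injh = bij_betw_imp_inj_on[OF h]
  have SP: "S v \<subseteq> P" if "v \<in> V" for v using S that by (simp add: sparse_def)
  have gV: "g i \<in> V" if "i \<in> {1..n}" for i using bij_betwE[OF g] that by blast
  let ?S = "\<lambda>i. h ` S (g i)"
  have "sparse k r {1..m} {1..n} ?S"
    unfolding sparse_def
  proof (intro conjI allI impI ballI)
    fix i assume "i \<in> {1..n}"
    then show "?S i \<subseteq> {1..m}" using SP[OF gV] h by (auto simp: bij_betw_def)
  next
    fix T assume T: "T \<subseteq> {1..m}" "card T < k"
    define T' where "T' = {x \<in> P. h x \<in> T}"
    have T': "T' \<subseteq> P" by (auto simp: T'_def)
    have hT': "h ` T' = T" using T(1) h by (auto simp: T'_def bij_betw_def)
    have cT': "card T' = card T"
      using hT' card_image[OF inj_on_subset[OF injh T']] by simp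
    have "?S i \<subseteq> T \<longleftrightarrow> S (g i) \<subseteq> T'" if "i \<in> {1..n}" for i
      using SP[OF gV[OF that]] unfolding T'_def by blast
    then have "{i \<in> {1..n}. ?S i \<subseteq> T} = {i \<in> {1..n}. S (g i) \<subseteq> T'}"
      by blast
    moreover have "g ` {i \<in> {1..n}. S (g i) \<subseteq> T'} = {v \<in> V. S v \<subseteq> T'}"
      using bij_betw_imp_surj_on[OF g] by blast
    moreover have "inj_on g {i \<in> {1..n}. S (g i) \<subseteq> T'}"
      using bij_betw_imp_inj_on[OF g] by (rule inj_on_subset) blast
    ultimately have eq: "card {i \<in> {1..n}. ?S i \<subseteq> T} = card {v \<in> V. S v \<subseteq> T'}"
      using card_image by fastforce
    have "r * card {v \<in> V. S v \<subseteq> T'} \<le> card T'"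
      using S T' T(2) unfolding sparse_def cT'[symmetric] by blast
    then show "r * card {i \<in> {1..n}. ?S i \<subseteq> T} \<le> card T"
      unfolding eq cT' .
  qed
  then have "mcbc_min n k m r \<le> (\<Sum>i\<in>{1..n}. card (?S i))"
    unfolding mcbc_min_def by (intro Least_le) (rule exI, erule sparse_imp_mcbc)
  also have "\<dots> = (\<Sum>i\<in>{1..n}. card (S (g i)))"
    using SP[OF gV] injh by (intro sum.cong refl card_image) (meson inj_on_subset)
  also have "\<dots> = (\<Sum>v\<in>V. card (S v))"
    by (rule sum.reindex_bij_betw[OF g])
  finally show ?thesis .
qed

text \<open>Full replication is sparse because fewer than \<open>k <= m\<close> servers are never
  all of them. So the minimum ranges over a nonempty set, and an optimal scheme can be
  dualised.\<close>

lemma mcbc_min_attained: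
  assumes "k \<le> n * r" "k \<le> m"
  obtains S where "sparse k r {1..m} {1..n} S" "mcbc_min n k m r = (\<Sum>i\<in>{1..n}. card (S i))"
proof -
  have "sparse k r {1..m} {1..n} (\<lambda>i. {1..m})"
    unfolding sparse_def
  proof (intro conjI allI impI ballI)
    fix T assume T: "T \<subseteq> {1..m}" "card T < k"
    then have "T \<noteq> {1..m}" using assms(2) by auto
    then have "{v \<in> {1..n}. {1..m} \<subseteq> T} = {}" using T by blast
    then show "r * card {v \<in> {1..n}. {1..m} \<subseteq> T} \<le> card T" by (metis card.empty mult_0_right zero_le)
  qed auto
  then have "\<exists>N C. is_mcbc n N k m r C" using sparse_imp_mcbc by blast
  then have "\<exists>C. is_mcbc n (mcbc_min n k m r) k m r C"
    unfolding mcbc_min_def by (rule LeastI_ex)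
  then show ?thesis
    using that mcbc_imp_sparse[OF _ assms(1)] by blast
qed

subsection \<open>Lower bounds\<close>

lemma card_supersets:
  assumes "finite P" "X \<subseteq> P" "card X \<le> s"
  shows "card {T. T \<subseteq> P \<and> card T = s \<and> X \<subseteq> T} = (card P - card X) choose (s - card X)"
proof -
  have finX: "finite X" using assms finite_subset by blast
  have "bij_betw (\<lambda>U. U \<union> X) {U. U \<subseteq> P - X \<and> card U = s - card X} {T. T \<subseteq> P \<and> card T = s \<and> X \<subseteq> T}"
  proof (rule bij_betw_byWitness[where f' = "\<lambda>T. T - X"])
    show "(\<lambda>U. U \<union> X) ` {U. U \<subseteq> P - X \<and> card U = s - card X} \<subseteq> {T. T \<subseteq> P \<and> card T = s \<and> X \<subseteq> T}"
    proof (intro image_subsetI CollectI conjI)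
      fix U assume "U \<in> {U. U \<subseteq> P - X \<and> card U = s - card X}"
      then have U: "U \<subseteq> P - X" "card U = s - card X" by auto
      then have "finite U" using assms(1) finite_subset by blast
      then have "card (U \<union> X) = card U + card X" using U finX by (intro card_Un_disjoint) auto
      then show "card (U \<union> X) = s" using U assms(3) by simp
      show "U \<union> X \<subseteq> P" using U assms(2) by blast
    qed simp
    show "(\<lambda>T. T - X) ` {T. T \<subseteq> P \<and> card T = s \<and> X \<subseteq> T} \<subseteq> {U. U \<subseteq> P - X \<and> card U = s - card X}"
      using finX by (auto simp: card_Diff_subset)
  qed auto
  then have "card {T. T \<subseteq> P \<and> card T = s \<and> X \<subseteq> T} = card {U. U \<subseteq> P - X \<and> card U = s - card X}"
    by (simp add: bij_betw_same_card)
  also have "\<dots> = card (P - X) choose (s - card X)"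
    using assms(1) by (intro n_subsets) simp
  also have "card (P - X) = card P - card X"
    using finX assms(2) by (rule card_Diff_subset)
  finally show ?thesis .
qed

text \<open>By Pascal's rule the coefficient grows by at least \<open>c\<close> when
  \<open>b\<close> grows by one. Equality holds for \<open>b = 0\<close> and \<open>b = 1\<close>,
  so nothing is lost on sets of size \<open>k - 1\<close> and \<open>k - 2\<close>.\<close>

lemma binomial_ge_mult:
  assumes "c \<ge> 1"
  shows "b * c + 1 \<le> (b + c) choose b"
proof (induction b)
  case (Suc b)
  have "c \<le> (b + c) choose Suc b"
  proof (induction c)
    case (Suc c)
    moreover have "1 \<le> (b + c) choose b" by (simp add: Suc_le_eq)
    ultimately show ?case by simp
  qed simp
  then show ?case using Suc by simp
qed simp

text \<open>These are the two secants. They are written over the integers because they turn negative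
  for \<open>card X > k\<close>, where \<open>g\<close> is 0.\<close>

lemma supersets_ge:
  assumes "finite P" "card P = m" "X \<subseteq> P" "0 < k" "k \<le> m"
  defines "g \<equiv> card {T. T \<subseteq> P \<and> card T = k - 1 \<and> X \<subseteq> T}"
  shows "(int k - 1 - int (card X)) * int (m - k + 1) + 1 \<le> int g"
    and "int k - int (card X) \<le> int g"
proof -
  show 1: "(int k - 1 - int (card X)) * int (m - k + 1) + 1 \<le> int g"
  proof (cases "card X \<le> k - 1")
    case True
    have "(k - 1 - card X) * (m - k + 1) + 1 \<le> ((k - 1 - card X) + (m - k + 1)) choose (k - 1 - card X)"
      by (rule binomial_ge_mult) simp
    also have "(k - 1 - card X) + (m - k + 1) = m - card X" using True assms by simp
    also have "(m - card X) choose (k - 1 - card X) = g"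
      unfolding g_def using card_supersets[OF assms(1,3) True] assms(2) by simp
    finally have "int ((k - 1 - card X) * (m - k + 1) + 1) \<le> int g" by (simp only: of_nat_le_iff)
    moreover have "int (k - 1 - card X) = int k - 1 - int (card X)" using True assms by simp
    ultimately show ?thesis by (simp only: of_nat_add of_nat_mult of_nat_1)
  next
    case False
    then have "(int k - 1 - int (card X)) * int (m - k + 1) \<le> (-1) * int (m - k + 1)"
      by (intro mult_right_mono) auto
    then show ?thesis by simp
  qed
  show "int k - int (card X) \<le> int g"
  proof (cases "card X \<le> k - 1")
    case True
    then have "(int k - 1 - int (card X)) * 1 \<le> (int k - 1 - int (card X)) * int (m - k + 1)"
      using assms by (intro mult_left_mono) auto
    then show ?thesis using 1 by simp
  qed simp
qed

text \<open>A set of size \<open>k - 1\<close> contains at most \<open>(k - 1) div r\<close> item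
  sets; this rounding is the source of the inner floor in all the values.\<close>

lemma sum_supersets_le:
  assumes S: "sparse k r P V S" and fin: "finite V" "finite P" and "card P = m" "0 < k" "0 < r"
  shows "(\<Sum>v\<in>V. card {T. T \<subseteq> P \<and> card T = k - 1 \<and> S v \<subseteq> T}) \<le> ((k - 1) div r) * (m choose (k - 1))"
proof -
  let ?L = "{T. T \<subseteq> P \<and> card T = k - 1}"
  have finL: "finite ?L" using fin by simp
  have "(\<Sum>v\<in>V. card {T. T \<subseteq> P \<and> card T = k - 1 \<and> S v \<subseteq> T}) = (\<Sum>v\<in>V. card {T \<in> ?L. S v \<subseteq> T})"
    by (intro sum.cong refl arg_cong[where f = card]) auto
  also have "\<dots> = (\<Sum>T\<in>?L. card {v \<in> V. S v \<subseteq> T})"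
    using fin finL by (intro sum_multicount_gen) auto
  also have "\<dots> \<le> (\<Sum>T\<in>?L. (k - 1) div r)"
  proof (rule sum_mono)
    fix T assume T: "T \<in> ?L"
    then have "r * card {v \<in> V. S v \<subseteq> T} \<le> card T"
      using S \<open>0 < k\<close> by (auto simp: sparse_def)
    then show "card {v \<in> V. S v \<subseteq> T} \<le> (k - 1) div r"
      using T \<open>0 < r\<close> by (simp add: less_eq_div_iff_mult_less_eq mult.commute)
  qed
  also have "\<dots> = ((k - 1) div r) * (m choose (k - 1))"
    using n_subsets[OF fin(2), of "k - 1"] assms(4) by simp
  finally show ?thesis .
qed

text \<open>The first two bounds sum the secant estimates over the items; the second avoids division
  so that rounding happens only once, later. The third tests \<open>T = S i\<close>: an item on
  fewer than \<open>k\<close> servers needs at least \<open>r\<close> of them.\<close>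

lemma mcbc_min_ge:
  assumes nr: "k \<le> n * r" and k: "0 < k" "k \<le> m" and r: "0 < r"
  defines "M \<equiv> ((k - 1) div r) * (m choose (k - 1))"
  shows "int (k * n) - int M \<le> int (mcbc_min n k m r)"
    and "(int ((k - 1) * n) - int (mcbc_min n k m r)) * int (m - k + 1) + int n \<le> int M"
    and "min r k * n \<le> mcbc_min n k m r"
proof -
  obtain S where S: "sparse k r {1..m} {1..n} S" and N: "mcbc_min n k m r = (\<Sum>i\<in>{1..n}. card (S i))"
    using mcbc_min_attained[OF nr k(2)] by blast
  have Sm: "S i \<subseteq> {1..m}" if "i \<in> {1..n}" for i using S that by (simp add: sparse_def)
  define g where "g i = card {T. T \<subseteq> {1..m} \<and> card T = k - 1 \<and> S i \<subseteq> T}" for i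
  have gM: "(\<Sum>i\<in>{1..n}. int (g i)) \<le> int M"
    using sum_supersets_le[OF S _ _ _ k(1) r, of m] by (simp add: g_def M_def flip: of_nat_sum of_nat_mult)
  have "int (k * n) - int (mcbc_min n k m r) = (\<Sum>i\<in>{1..n}. int k - int (card (S i)))"
    by (simp add: N sum_subtractf)
  also have "\<dots> \<le> (\<Sum>i\<in>{1..n}. int (g i))"
    using supersets_ge(2)[OF _ _ Sm k] by (intro sum_mono) (simp add: g_def)
  finally show "int (k * n) - int M \<le> int (mcbc_min n k m r)" using gM by linarith
  have "(int ((k - 1) * n) - int (mcbc_min n k m r)) * int (m - k + 1) + int n
      = (\<Sum>i\<in>{1..n}. (int k - 1 - int (card (S i))) * int (m - k + 1) + 1)"
    using k by (simp add: N sum_subtractf sum.distrib of_nat_diff algebra_simps flip: sum_distrib_right sum_distrib_left)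
  also have "\<dots> \<le> (\<Sum>i\<in>{1..n}. int (g i))"
    using supersets_ge(1)[OF _ _ Sm k] by (intro sum_mono) (simp add: g_def)
  finally show "(int ((k - 1) * n) - int (mcbc_min n k m r)) * int (m - k + 1) + int n \<le> int M"
    using gM by linarith
  have "min r k \<le> card (S i)" if i: "i \<in> {1..n}" for i
  proof (cases "card (S i) < k")
    case True
    then have "r * card {v \<in> {1..n}. S v \<subseteq> S i} \<le> card (S i)"
      using S Sm[OF i] unfolding sparse_def by blast
    moreover have "card {i} \<le> card {v \<in> {1..n}. S v \<subseteq> S i}"
      using i by (intro card_mono) auto
    ultimately have "r * 1 \<le> card (S i)"
      by (metis card.empty card_insert_disjoint finite.emptyI empty_iff One_nat_def le_trans mult_le_mono2)
    then show ?thesis by simp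
  qed simp
  then have "(\<Sum>i\<in>{1..n}. min r k) \<le> mcbc_min n k m r"
    unfolding N by (intro sum_mono)
  then show "min r k * n \<le> mcbc_min n k m r" by (simp add: mult.commute)
qed

subsection \<open>Constructions\<close>

lemma sum_card_subfamily:
  assumes "finite P" "card P = m" "s < m" "K \<subseteq> {X. X \<subseteq> P \<and> card X = s}"
  shows "(\<Sum>T | T \<subseteq> P \<and> card T = Suc s. card {X \<in> K. X \<subseteq> T}) = card K * (m - s)"
proof -
  let ?L = "{T. T \<subseteq> P \<and> card T = Suc s}"
  have fin: "finite ?L" "finite K" using assms(1,4) by (auto intro: finite_subset[of _ "Pow P"])
  have "(\<Sum>T\<in>?L. card {X \<in> K. X \<subseteq> T}) = (\<Sum>X\<in>K. card {T \<in> ?L. X \<subseteq> T})"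
    using fin by (intro sum_multicount_gen) auto
  also have "\<dots> = (\<Sum>X\<in>K. m - s)"
  proof (rule sum.cong)
    fix X assume "X \<in> K"
    then have "card {T. T \<subseteq> P \<and> card T = Suc s \<and> X \<subseteq> T} = (m - s) choose 1"
      using card_supersets[OF assms(1), of X "Suc s"] assms(2,4) by auto
    then show "card {T \<in> ?L. X \<subseteq> T} = m - s" by (simp add: conj_assoc)
  qed simp
  finally show ?thesis by simp
qed

text \<open>Each \<open>(k - 1)\<close>-set offers \<open>(k - 1) div r\<close> slots. A member of
  \<open>K\<close> occupies one slot in each of its \<open>m - k + 2\<close> supersets of that size,
  \<open>a\<close> further slots are filled by copies of the \<open>(k - 1)\<close>-sets themselves,
  and \<open>z\<close> items share one \<open>k\<close>-set, which no tested \<open>T\<close> can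
  contain.\<close>

lemma mcbc_min_layers_le:
  fixes P :: "'b set" and K :: "'b set set"
  assumes P: "finite P" "card P = m" and k: "0 < k" "k \<le> m" and r: "0 < r"
    and K: "K \<subseteq> {X. X \<subseteq> P \<and> card X = k - 2}" "K \<noteq> {} \<Longrightarrow> r \<le> k - 2"
    and K1: "\<And>T. T \<subseteq> P \<Longrightarrow> card T = k - 1 \<Longrightarrow> card {X \<in> K. X \<subseteq> T} \<le> 1"
    and a: "a + card K * (m - k + 2) \<le> ((k - 1) div r) * (m choose (k - 1))"
  shows "mcbc_min (card K + a + z) k m r \<le> (k - 2) * card K + (k - 1) * a + k * z"
proof -
  define f where "f = (k - 1) div r"
  let ?L = "{T. T \<subseteq> P \<and> card T = k - 1}"
  let ?\<kappa> = "\<lambda>T. card {X \<in> K. X \<subseteq> T}"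
  have finK: "finite K" using K(1) P(1) by (auto intro: finite_subset[of _ "Pow P"])
  have KP: "X \<subseteq> P" "card X = k - 2" if "X \<in> K" for X using K(1) that by blast+
  have finL: "finite ?L" using P(1) by simp
  \<comment> \<open>\<open>0 < r\<close> and \<open>r <= k - 2\<close> force \<open>k >= 3\<close>,
    so the truncated differences are exact whenever \<open>K\<close> is nonempty.\<close>
  have k3: "3 \<le> k" "1 \<le> f" if "K \<noteq> {}"
  proof -
    show "3 \<le> k" using K(2)[OF that] r by simp
    have "r \<le> k - 1" using K(2)[OF that] by simp
    then show "1 \<le> f" using r by (simp add: f_def less_eq_div_iff_mult_less_eq)
  qed
  have \<kappa>f: "?\<kappa> T \<le> f" if "T \<in> ?L" for T
  proof (cases "K = {}")
    case False
    then show ?thesis using K1[of T] that k3 by force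
  qed simp
  \<comment> \<open>The slots left free by \<open>K\<close>; the second component tells apart the
    items that are placed on the same set \<open>T\<close>.\<close>
  define W0 where "W0 = (SIGMA T:?L. {..<f - ?\<kappa> T})"
  have sum\<kappa>: "(\<Sum>T\<in>?L. ?\<kappa> T) = card K * (m - k + 2)"
  proof (cases "K = {}")
    case False
    then have "Suc (k - 2) = k - 1" "k - 2 < m" "m - (k - 2) = m - k + 2" using k3 k by auto
    then show ?thesis using sum_card_subfamily[OF P _ K(1)] by simp
  qed simp
  have "card W0 + card K * (m - k + 2) = (\<Sum>T\<in>?L. (f - ?\<kappa> T) + ?\<kappa> T)"
  proof -
    have "card W0 = (\<Sum>T\<in>?L. f - ?\<kappa> T)" using finL by (simp add: W0_def)
    then show ?thesis by (simp only: sum.distrib sum\<kappa>)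
  qed
  also have "\<dots> = (\<Sum>T\<in>?L. f)" using \<kappa>f by (intro sum.cong) auto
  also have "\<dots> = f * (m choose (k - 1))"
    using n_subsets[OF P(1), of "k - 1"] P(2) by simp
  finally have "a \<le> card W0" using a by (simp add: f_def)
  moreover have finW0: "finite W0" using finL by (simp add: W0_def)
  ultimately obtain W where W: "W \<subseteq> W0" "card W = a"
    by (metis obtain_subset_with_card_n)
  have finW: "finite W" using W finW0 finite_subset by blast
  obtain Q where Q: "Q \<subseteq> P" "card Q = k" using k P by (metis obtain_subset_with_card_n)
  let ?K = "K \<times> {0::nat}" and ?Z = "{Q} \<times> {..<z}"
  define V where "V = ?K \<union> W \<union> ?Z"
  have fstW: "card (fst v) = k - 1" "fst v \<subseteq> P" if "v \<in> W" for v
  proof -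
    have "fst v \<in> ?L" using subsetD[OF W(1) that] unfolding W0_def by auto
    then show "card (fst v) = k - 1" "fst v \<subseteq> P" by blast+
  qed
  have disj: "?K \<inter> W = {}" "(?K \<union> W) \<inter> ?Z = {}"
  proof -
    have "card X \<noteq> k - 1" "card X \<noteq> k" if "X \<in> K" for X
      using that K(1) k3 by force+
    then show "?K \<inter> W = {}" "(?K \<union> W) \<inter> ?Z = {}"
      using fstW Q k by fastforce+
  qed
  have sumV: "(\<Sum>v\<in>V. h v) = (\<Sum>X\<in>K. h (X, 0)) + (\<Sum>v\<in>W. h v) + (\<Sum>i<z. h (Q, i))" for h :: "'b set \<times> nat \<Rightarrow> nat"
  proof -
    have "(\<Sum>v\<in>V. h v) = (\<Sum>v\<in>?K. h v) + (\<Sum>v\<in>W. h v) + (\<Sum>v\<in>?Z. h v)"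
      unfolding V_def using disj finK finW by (simp add: sum.union_disjoint)
    moreover have "(\<Sum>v\<in>?K. h v) = (\<Sum>X\<in>K. h (X, 0))"
      by (rule sum.reindex_cong[of "\<lambda>X. (X, 0)"]) (auto simp: inj_on_def)
    moreover have "(\<Sum>v\<in>?Z. h v) = (\<Sum>i<z. h (Q, i))"
      by (rule sum.reindex_cong[of "\<lambda>i. (Q, i)"]) (auto simp: inj_on_def)
    ultimately show ?thesis by simp
  qed
  have finV: "finite V" using finK finW by (simp add: V_def)
  have cardV: "card V = card K + a + z"
    using sumV[of "\<lambda>_. 1"] W(2) by simp
  have "sparse k r P V fst"
    unfolding sparse_def
  proof (intro conjI allI impI ballI)
    fix v assume "v \<in> V"
    then consider "v \<in> ?K" | "v \<in> W" | "v \<in> ?Z" unfolding V_def by blast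
    then show "fst v \<subseteq> P" using fstW(2)[of v] KP(1)[of "fst v"] Q(1) by cases auto
  next
    fix T assume T: "T \<subseteq> P" "card T < k"
    have finT: "finite T" using T P(1) finite_subset by blast
    have sizes: "card (fst v) \<le> card T" if "v \<in> V" "fst v \<subseteq> T" for v
      using that finT by (simp add: card_mono)
    \<comment> \<open>All stored sets have at least \<open>k - 2\<close> elements. At size
      \<open>k - 1\<close> the slots are the limit. A \<open>T\<close> of size \<open>k - 2\<close>
      contains at most itself, and that single item is affordable because
      \<open>r <= k - 2\<close>.\<close>
    consider "card T = k - 1" | "card T = k - 2" "k \<ge> 2" | "card T + 2 < k" using T(2) by linarith
    then show "r * card {v \<in> V. fst v \<subseteq> T} \<le> card T"
    proof cases
      case 1
      have "{v \<in> V. fst v \<subseteq> T} \<subseteq> {X \<in> K. X \<subseteq> T} \<times> {0} \<union> {T} \<times> {..<f - ?\<kappa> T}"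
      proof
        fix v assume v: "v \<in> {v \<in> V. fst v \<subseteq> T}"
        then consider "v \<in> ?K" | "v \<in> W" | "v \<in> ?Z" by (auto simp: V_def)
        then show "v \<in> {X \<in> K. X \<subseteq> T} \<times> {0} \<union> {T} \<times> {..<f - ?\<kappa> T}"
        proof cases
          case 2
          then have "fst v = T" using fstW v 1 finT by (intro card_subset_eq) auto
          then show ?thesis using 2 W(1) by (auto simp: W0_def)
        next
          case 3
          then show ?thesis using v sizes[of v] Q 1 k by auto
        qed (use v in auto)
      qed
      then have "card {v \<in> V. fst v \<subseteq> T} \<le> card ({X \<in> K. X \<subseteq> T} \<times> {0::nat} \<union> {T} \<times> {..<f - ?\<kappa> T})"
        using finK by (intro card_mono) auto
      also have "\<dots> \<le> ?\<kappa> T + (f - ?\<kappa> T)"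
        by (rule order_trans[OF card_Un_le]) (simp add: card_cartesian_product)
      also have "\<dots> = f" using \<kappa>f[of T] 1 T by simp
      finally have "r * card {v \<in> V. fst v \<subseteq> T} \<le> r * f" by simp
      also have "\<dots> \<le> k - 1" by (simp add: f_def)
      finally show ?thesis using 1 by simp
    next
      case 2
      have "{v \<in> V. fst v \<subseteq> T} \<subseteq> {X \<in> K. X = T} \<times> {0}"
      proof
        fix v assume v: "v \<in> {v \<in> V. fst v \<subseteq> T}"
        then have le: "card (fst v) \<le> k - 2" using sizes[of v] 2 by simp
        then have "v \<in> ?K" using v fstW(1)[of v] Q(2) 2 unfolding V_def by auto
        moreover from this have "fst v = T" using KP(2)[of "fst v"] v 2 finT by (intro card_subset_eq) auto
        ultimately show "v \<in> {X \<in> K. X = T} \<times> {0}" by auto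
      qed
      also have "\<dots> = (if T \<in> K then {(T, 0)} else {})" by auto
      finally have sub: "{v \<in> V. fst v \<subseteq> T} \<subseteq> (if T \<in> K then {(T, 0)} else {})" .
      show ?thesis
      proof (cases "T \<in> K")
        case True
        then have "card {v \<in> V. fst v \<subseteq> T} \<le> card {(T, 0::nat)}"
          using sub by (intro card_mono) auto
        then have "r * card {v \<in> V. fst v \<subseteq> T} \<le> r * 1" by (intro mult_le_mono2) simp
        also have "\<dots> \<le> k - 2" using K(2) True by auto
        finally show ?thesis using 2 by simp
      next
        case False
        then have "{v \<in> V. fst v \<subseteq> T} = {}" using sub unfolding if_not_P[OF False] by blast
        then show ?thesis by (metis card.empty mult_0_right zero_le)
      qed
    next
      case 3
      have "card (fst v) \<ge> k - 2" if "v \<in> V" for v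
        using that fstW(1)[of v] KP(2)[of "fst v"] Q(2) unfolding V_def by auto
      then have "{v \<in> V. fst v \<subseteq> T} = {}" using sizes 3 by fastforce
      then show ?thesis by (metis card.empty mult_0_right zero_le)
    qed
  qed
  then have "mcbc_min (card K + a + z) k m r \<le> (\<Sum>v\<in>V. card (fst v))"
    using mcbc_min_le[OF finV P(1) _ cardV P(2)] by blast
  also have "\<dots> = (\<Sum>X\<in>K. card X) + (\<Sum>v\<in>W. card (fst v)) + (\<Sum>i<z. card Q)"
    by (simp add: sumV)
  also have "\<dots> = (k - 2) * card K + (k - 1) * a + k * z"
  proof -
    have "(\<Sum>X\<in>K. card X) = (\<Sum>X\<in>K. k - 2)" using KP by (intro sum.cong) auto
    moreover have "(\<Sum>v\<in>W. card (fst v)) = (\<Sum>v\<in>W. k - 1)" using fstW by (intro sum.cong) auto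
    ultimately show ?thesis using Q W(2) by (simp add: mult.commute)
  qed
  finally show ?thesis .
qed

lemma count_list_True: "count_list x True = card {i. i < length x \<and> x ! i}"
proof -
  have "count_list x True = length (filter (\<lambda>b. b) x)"
    by (induction x) auto
  then show ?thesis by (simp add: length_filter_conv_card)
qed

lemma finite_constant_weight_codes: "finite {S. constant_weight_code m d w S}"
proof (rule finite_subset)
  show "{S. constant_weight_code m d w S} \<subseteq> Pow {x. set x \<subseteq> UNIV \<and> length x = m}"
    by (auto simp: constant_weight_code_def)
qed (use finite_lists_length_eq[of "UNIV :: bool set" m] in simp)

lemma max_constant_weight_code_attained:
  obtains S where "constant_weight_code m d w S" "card S = max_constant_weight_code m d w"
proof -
  have "max_constant_weight_code m d w \<in> {card S |S. constant_weight_code m d w S}"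
    unfolding max_constant_weight_code_def
  proof (rule Max_in)
    show "finite {card S |S. constant_weight_code m d w S}"
      using finite_constant_weight_codes by (simp add: setcompr_eq_image)
    have "constant_weight_code m d w {}" by (simp add: constant_weight_code_def)
    then show "{card S |S. constant_weight_code m d w S} \<noteq> {}" by blast
  qed
  then show ?thesis using that by auto
qed

text \<open>Words are replaced by their supports. Two \<open>w\<close>-sets inside a set of size
  \<open>w + 1\<close> miss one point of it each, so their distance is at most 2, which the code
  excludes.\<close>

lemma set_family_of_code:
  obtains K where "K \<subseteq> {X. X \<subseteq> {..<m} \<and> card X = w}" "card K = max_constant_weight_code m 4 w"
    "\<And>T. finite T \<Longrightarrow> card T = Suc w \<Longrightarrow> card {X \<in> K. X \<subseteq> T} \<le> 1"
proof -
  obtain C where C: "constant_weight_code m 4 w C" "card C = max_constant_weight_code m 4 w"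
    by (rule max_constant_weight_code_attained)
  define \<phi> where "\<phi> x = {i. i < m \<and> x ! i}" for x :: "bool list"
  have len: "length x = m" "card (\<phi> x) = w" if "x \<in> C" for x
    using C(1) that by (auto simp: constant_weight_code_def count_list_True \<phi>_def)
  have inj: "inj_on \<phi> C"
  proof (rule inj_onI)
    fix x y assume xy: "x \<in> C" "y \<in> C" "\<phi> x = \<phi> y"
    have "x ! i = y ! i" if "i < m" for i
      using xy(3) that unfolding \<phi>_def by blast
    then show "x = y" using len xy by (intro nth_equalityI) auto
  qed
  show ?thesis
  proof (rule that[of "\<phi> ` C"])
    show "\<phi> ` C \<subseteq> {X. X \<subseteq> {..<m} \<and> card X = w}" using len by (auto simp: \<phi>_def)
    show "card (\<phi> ` C) = max_constant_weight_code m 4 w" using C(2) inj by (simp add: card_image)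
    fix T :: "nat set" assume T: "finite T" "card T = Suc w"
    have "X = Y" if X: "X \<in> \<phi> ` C" "X \<subseteq> T" and Y: "Y \<in> \<phi> ` C" "Y \<subseteq> T" for X Y
    proof (rule ccontr)
      assume "X \<noteq> Y"
      obtain x y where xy: "x \<in> C" "y \<in> C" "X = \<phi> x" "Y = \<phi> y" using X Y by blast
      then have "x \<noteq> y" using \<open>X \<noteq> Y\<close> by blast
      then have "4 \<le> hamming_dist x y"
        using C(1) xy by (simp add: constant_weight_code_def)
      also have "hamming_dist x y = card ((X - Y) \<union> (Y - X))"
        unfolding hamming_dist_def using xy len by (intro arg_cong[where f = card]) (auto simp: \<phi>_def)
      also have "\<dots> \<le> card (T - Y) + card (T - X)"
        using X Y T by (intro order_trans[OF card_Un_le] add_mono card_mono) auto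
      also have "\<dots> = 2"
        using X(2) Y(2) T len(2) xy finite_subset[OF X(2) T(1)] finite_subset[OF Y(2) T(1)]
        by (simp add: card_Diff_subset)
      finally show False by simp
    qed
    then show "card {X \<in> \<phi> ` C. X \<subseteq> T} \<le> 1"
      by (intro card_le_Suc0_iff_eq[THEN iffD2, folded One_nat_def]) (use T in \<open>auto intro: finite_subset[of _ "Pow T"]\<close>)
  qed
qed

subsection \<open>Affine planes\<close>

text \<open>
  \<open>D\<close> is the set of directions; the lines with direction \<open>d\<close> are the fibres of \<open>\<pi> d\<close>.
\<close>

locale affine_plane =
  fixes q :: nat and D :: "'d set" and K :: "'a set" and P :: "'p set" and \<pi> :: "'d \<Rightarrow> 'p \<Rightarrow> 'a"
  assumes finite_D: "finite D" and card_D: "card D = q + 1"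
    and finite_K: "finite K" and card_K: "card K = q"
    and finite_P: "finite P" and card_P: "card P = q\<^sup>2"
    and q_pos: "q > 0"
    and proj_in: "d \<in> D \<Longrightarrow> p \<in> P \<Longrightarrow> \<pi> d p \<in> K"
    and proj_inj: "d \<in> D \<Longrightarrow> d' \<in> D \<Longrightarrow> d \<noteq> d' \<Longrightarrow> p \<in> P \<Longrightarrow> p' \<in> P \<Longrightarrow>
      \<pi> d p = \<pi> d p' \<Longrightarrow> \<pi> d' p = \<pi> d' p' \<Longrightarrow> p = p'"
begin

definition line :: "'d \<times> 'a \<Rightarrow> 'p set" where
  "line l = {p \<in> P. \<pi> (fst l) p = snd l}"

lemma line_subset: "line l \<subseteq> P" and finite_line: "finite (line l)"
  using finite_P by (auto simp: line_def)

lemma inj_on_proj_pair: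
  assumes "d \<in> D" "d' \<in> D" "d \<noteq> d'"
  shows "inj_on (\<lambda>p. (\<pi> d p, \<pi> d' p)) P"
  by (rule inj_onI) (use proj_inj[OF assms] in blast)

text \<open>Two directions form a coordinate system: the map to \<open>K \<times> K\<close> is
  injective between sets of size \<open>q^2\<close>, hence bijective. A line fixes one coordinate
  while the other runs through \<open>K\<close>.\<close>

lemma card_line:
  assumes "l \<in> D \<times> K"
  shows "card (line l) = q"
proof -
  obtain d v where l: "l = (d, v)" "d \<in> D" "v \<in> K" using assms by blast
  have "card (D - {d}) = q" using finite_D l(2) card_D by simp
  then obtain d' where d': "d' \<in> D" "d \<noteq> d'" using q_pos by (metis Diff_iff card.empty equals0I insertI1 less_irrefl)
  let ?g = "\<lambda>p. (\<pi> d p, \<pi> d' p)"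
  have inj: "inj_on ?g P" using inj_on_proj_pair[OF l(2) d'] .
  have "?g ` P \<subseteq> K \<times> K" using proj_in l d' by auto
  moreover have "card (?g ` P) = card (K \<times> K)"
    using card_image[OF inj] by (simp add: card_P card_cartesian_product card_K power2_eq_square)
  ultimately have surj: "?g ` P = K \<times> K" using finite_K by (intro card_subset_eq) auto
  have "\<pi> d' ` line l = K"
  proof
    show "\<pi> d' ` line l \<subseteq> K" using proj_in d' by (auto simp: line_def)
    show "K \<subseteq> \<pi> d' ` line l"
    proof
      fix w assume "w \<in> K"
      then have "(v, w) \<in> ?g ` P" using surj l(3) by blast
      then show "w \<in> \<pi> d' ` line l" by (auto simp: line_def l(1))
    qed
  qed
  moreover have "inj_on (\<pi> d') (line l)"
    by (rule inj_onI) (use proj_inj[OF l(2) d'] in \<open>auto simp: line_def l(1)\<close>)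
  ultimately show ?thesis using card_image card_K by metis
qed

lemma card_line_Int:
  assumes "l \<in> D \<times> K" "l' \<in> D \<times> K" "l \<noteq> l'"
  shows "card (line l \<inter> line l') \<le> 1"
proof -
  have "p = p'" if "p \<in> line l \<inter> line l'" "p' \<in> line l \<inter> line l'" for p p'
  proof (cases "fst l = fst l'")
    case True
    then show ?thesis using that assms(3) by (auto simp: line_def prod_eq_iff)
  next
    case False
    then show ?thesis
      using that assms proj_inj[of "fst l" "fst l'" p p'] by (auto simp: line_def)
  qed
  then show ?thesis
    using finite_line by (simp add: card_le_Suc0_iff_eq)
qed

text \<open>When \<open>a\<close> lines are present, a new one meets each of them in at most one
  point and brings at least \<open>q - a\<close> new points. Summation gives half of the left side.
  Doubling avoids the fraction, and integers allow \<open>a > q\<close>.\<close>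

lemma card_Union_lines:
  assumes "A \<subseteq> D \<times> K"
  shows "int (card A) * (2 * int q - int (card A) + 1) \<le> 2 * int (card (\<Union>(line ` A)))"
proof -
  have "finite A" using assms finite_D finite_K finite_subset by blast
  then show ?thesis using assms
  proof (induction A)
    case (insert l A)
    let ?U = "\<Union>(line ` A)"
    have finU: "finite ?U" using insert.hyps finite_line by blast
    have "card (line l \<inter> ?U) = card (\<Union>l'\<in>A. line l \<inter> line l')" by (simp only: Int_UN_distrib)
    also have "\<dots> \<le> (\<Sum>l'\<in>A. card (line l \<inter> line l'))"
      using insert.hyps(1) by (rule card_UN_le)
    also have "\<dots> \<le> (\<Sum>l'\<in>A. 1)"
      using insert by (intro sum_mono card_line_Int) auto
    finally have "card (line l \<inter> ?U) \<le> card A" by simp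
    moreover have "card (line l - ?U) = card (line l) - card (line l \<inter> ?U)"
      using finite_line by (simp add: card_Diff_subset_Int)
    moreover have "card (line l) = q" using insert.prems by (intro card_line) auto
    ultimately have new: "int q - int (card A) \<le> int (card (line l - ?U))" by linarith
    have "\<Union>(line ` insert l A) = ?U \<union> (line l - ?U)" by auto
    then have "card (\<Union>(line ` insert l A)) = card ?U + card (line l - ?U)"
      using finU finite_line[of l] by (simp add: card_Un_disjoint Diff_disjoint del: Un_Diff_cancel)
    moreover have "int (card A) * (2 * int q - int (card A) + 1) \<le> 2 * int (card ?U)"
      using insert by simp
    moreover have "int (card (insert l A)) = int (card A) + 1" using insert.hyps by simp
    ultimately show ?case using new by (simp add: algebra_simps)
  qed simp
qed

text \<open>With \<open>a\<close> lines inside \<open>T\<close>, the union bound reads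
  \<open>a * (2 * q - a + 1) <= 2 * card T\<close>. The second factor is at least
  \<open>2 * r\<close> up to \<open>a = 2 * (q - r) + 1\<close>, as desired. One line more would
  already cover \<open>(q - r + 1) * (2 * r - 1)\<close> points, which is the limit set for
  \<open>k\<close>.\<close>

lemma sparse_lines:
  assumes r: "0 < r" "r \<le> q" and k: "k \<le> (q - r + 1) * (2 * r - 1)"
  shows "sparse k r P (D \<times> K) line"
  unfolding sparse_def
proof (intro conjI allI impI ballI)
  fix T assume T: "T \<subseteq> P" "card T < k"
  define A where "A = {l \<in> D \<times> K. line l \<subseteq> T}"
  have A: "A \<subseteq> D \<times> K" by (auto simp: A_def)
  have finT: "finite T" using T(1) finite_P finite_subset by blast
  have bound: "int (card B) * (2 * int q - int (card B) + 1) \<le> 2 * int (card T)" if "B \<subseteq> A" for B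
  proof -
    have "card (\<Union>(line ` B)) \<le> card T" using that finT by (intro card_mono) (auto simp: A_def)
    then show ?thesis using card_Union_lines[of B] that A by force
  qed
  have "card A \<le> 2 * (q - r) + 1"
  proof (rule ccontr)
    assume "\<not> card A \<le> 2 * (q - r) + 1"
    then have "2 * (q - r + 1) \<le> card A" by simp
    \<comment> \<open>The subfamily has exactly the critical size because the quadratic bound
      decreases again for large families.\<close>
    then obtain B where B: "B \<subseteq> A" "card B = 2 * (q - r + 1)" by (metis obtain_subset_with_card_n)
    have "int (card B) = 2 * (int q - int r + 1)" using B(2) r by simp
    then have "(int q - int r + 1) * (2 * int r - 1) \<le> int (card T)"
      using bound[OF B(1)] unfolding \<open>int (card B) = _\<close> by (simp add: algebra_simps)
    moreover have "int ((q - r + 1) * (2 * r - 1)) = (int q - int r + 1) * (2 * int r - 1)"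
    proof -
      have "int (q - r + 1) = int q - int r + 1" "int (2 * r - 1) = 2 * int r - 1"
        using r by simp_all
      then show ?thesis by (simp only: of_nat_mult)
    qed
    ultimately have "(q - r + 1) * (2 * r - 1) \<le> card T" by linarith
    then show False using T(2) k by simp
  qed
  then have "int (card A) * (2 * int r) \<le> int (card A) * (2 * int q - int (card A) + 1)"
    using r by (intro mult_left_mono) auto
  also have "\<dots> \<le> 2 * int (card T)" by (rule bound) simp
  finally have "int (r * card A) \<le> int (card T)" by (simp add: mult.commute)
  then show "r * card {l \<in> D \<times> K. line l \<subseteq> T} \<le> card T" by (simp only: of_nat_le_iff A_def)
qed (use line_subset in blast)

text \<open>
  The sum is the number of lines that meet \<open>U\<close>. If \<open>s\<close> of them have direction \<open>d0\<close>, then every other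
  direction contributes at least \<open>card U / s\<close>, and \<open>s * s + q * card U \<ge> s * (card U + q)\<close> because
  \<open>s \<le> min q (card U)\<close>.
\<close>

lemma sum_card_proj_ge:
  assumes U: "U \<subseteq> P" "U \<noteq> {}"
  shows "card U + q \<le> (\<Sum>d\<in>D. card (\<pi> d ` U))"
proof -
  have finU: "finite U" using U(1) finite_P finite_subset by blast
  obtain d0 where d0: "d0 \<in> D" using card_D by fastforce
  define s where "s = card (\<pi> d0 ` U)"
  have s: "1 \<le> s" "s \<le> card U" "s \<le> q"
  proof -
    show "1 \<le> s" using finU U(2) by (simp add: s_def Suc_le_eq card_gt_0_iff)
    show "s \<le> card U" unfolding s_def using finU by (rule card_image_le)
    show "s \<le> q" unfolding s_def card_K[symmetric]
      using finite_K proj_in[OF d0] U(1) by (intro card_mono) auto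
  qed
  have le: "card U \<le> s * card (\<pi> d ` U)" if "d \<in> D - {d0}" for d
  proof -
    have "card U = card ((\<lambda>p. (\<pi> d0 p, \<pi> d p)) ` U)"
      using inj_on_proj_pair[OF d0, of d] that U(1) by (subst card_image) (auto intro: inj_on_subset)
    also have "\<dots> \<le> card (\<pi> d0 ` U \<times> \<pi> d ` U)"
      using finU by (intro card_mono) auto
    finally show ?thesis by (simp add: card_cartesian_product s_def)
  qed
  obtain a b where "card U = s + a" "q = s + b" using s by (metis le_iff_add)
  then have "s * (card U + q) \<le> s * s + q * card U" by (simp add: algebra_simps)
  also have "\<dots> = s * s + (\<Sum>d\<in>D - {d0}. card U)"
    using d0 finite_D card_D by simp
  also have "\<dots> \<le> s * s + (\<Sum>d\<in>D - {d0}. s * card (\<pi> d ` U))"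
    using le by (intro add_left_mono sum_mono) auto
  also have "\<dots> = s * (\<Sum>d\<in>D. card (\<pi> d ` U))"
    using sum.remove[OF finite_D d0, of "\<lambda>d. card (\<pi> d ` U)"]
    by (simp add: s_def distrib_left sum_distrib_left)
  finally show ?thesis using s(1) by simp
qed

text \<open>The count is made in the complement \<open>U\<close> of \<open>T\<close>: of the
  \<open>q^2 + q\<close> lines at least \<open>card U + q\<close> meet \<open>U\<close>, which
  leaves at most \<open>q^2 - card U = card T\<close> lines inside \<open>T\<close>.\<close>

lemma sparse_lines_1:
  assumes k: "k \<le> q\<^sup>2"
  shows "sparse k 1 P (D \<times> K) line"
  unfolding sparse_def
proof (intro conjI allI impI ballI)
  fix T assume T: "T \<subseteq> P" "card T < k"
  define U where "U = P - T"
  have finT: "finite T" using T(1) finite_P finite_subset by blast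
  have cardU: "card U = q\<^sup>2 - card T" using T(1) finT card_P by (simp add: U_def card_Diff_subset)
  then have "card U > 0" using T(2) k by simp
  then have "U \<noteq> {}" by auto
  moreover have "U \<subseteq> P" by (simp add: U_def)
  ultimately have U: "U \<subseteq> P" "U \<noteq> {}" by blast+
  define H where "H = (SIGMA d:D. \<pi> d ` U)"
  have H: "H \<subseteq> D \<times> K" using proj_in U by (auto simp: H_def)
  have finH: "finite H" using H finite_D finite_K finite_subset by blast
  have "card H = (\<Sum>d\<in>D. card (\<pi> d ` U))"
    using finite_D finite_P U(1) by (simp add: H_def finite_subset)
  then have "card U + q \<le> card H" using sum_card_proj_ge[OF U] by simp
  moreover have "line (d, v) \<subseteq> T \<longleftrightarrow> (d, v) \<notin> H" if "d \<in> D" for d v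
    using that by (auto simp: H_def U_def line_def)
  then have "{l \<in> D \<times> K. line l \<subseteq> T} = D \<times> K - H" by auto
  moreover have "card (D \<times> K - H) = (q + 1) * q - card H"
    using H finH by (simp add: card_Diff_subset card_cartesian_product card_D card_K)
  moreover have "card T \<le> q\<^sup>2" using T k by simp
  ultimately show "1 * card {l \<in> D \<times> K. line l \<subseteq> T} \<le> card T"
    using cardU by (simp add: power2_eq_square)
qed (use line_subset in blast)

end

subsection \<open>Blocks and complements of transversals\<close>

text \<open>The sets of all \<open>i * r + j\<close> with \<open>i < f\<close>, one for each
  \<open>j < r\<close>, are disjoint transversals. Two of their complements cover everything, so a
  proper \<open>T\<close> contains at most one. If it contains \<open>b\<close> blocks besides, its
  missing points lie on that transversal in the other \<open>f - b\<close> blocks, hence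
  \<open>card T >= k - (f - b)\<close>.\<close>

lemma sparse_blocks:
  fixes k r n :: nat
  assumes r: "0 < r"
  defines "f \<equiv> k div r" and "c \<equiv> (if r dvd k then 0 else r)"
  defines "S \<equiv> \<lambda>v. if v < f then {v * r..<v * r + r}
    else if v < f + c then {..<k} - (\<lambda>i. i * r + (v - f)) ` {..<f} else {..<k}"
  shows "sparse k r {..<k} {..<n} S"
    and "f + c \<le> n \<Longrightarrow> (\<Sum>v<n. card (S v)) = f * r + c * (k - f) + (n - (f + c)) * k"
proof -
  have k: "k = f * r + k mod r" by (simp add: f_def)
  have ub: "i * r + j < f * r" if "i < f" "j < r" for i j
  proof -
    have "i * r + j < Suc i * r" using that by simp
    also have "\<dots> \<le> f * r" using that by (intro mult_le_mono1) simp
    finally show ?thesis .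
  qed
  have blk: "x \<in> {v * r..<v * r + r} \<longleftrightarrow> x div r = v" for x v
  proof
    assume "x \<in> {v * r..<v * r + r}"
    then show "x div r = v"
      using r by (intro div_nat_eqI) (auto simp: mult.commute)
  next
    assume "x div r = v"
    then show "x \<in> {v * r..<v * r + r}"
      using r div_mult_mod_eq[of x r] mod_less_divisor[OF r, of x] by (metis add_le_cancel_left atLeastLessThan_iff le_add1 nat_add_left_cancel_less)
  qed
  have disj: "{v * r..<v * r + r} \<inter> {w * r..<w * r + r} = {}" if "v \<noteq> w" for v w
    using that by (metis blk disjoint_iff)
  have SP: "S v \<subseteq> {..<k}" for v
  proof
    fix x assume x: "x \<in> S v"
    show "x \<in> {..<k}"
    proof (cases "v < f")
      case True
      then have "v * r \<le> x" "x < v * r + r" using x by (auto simp: S_def)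
      then have "x - v * r < r" "v * r + (x - v * r) = x" by linarith+
      then have "x < f * r" using ub[OF True, of "x - v * r"] by simp
      then show ?thesis using k by simp
    next
      case False
      then show ?thesis using x by (auto simp: S_def split: if_splits)
    qed
  qed
  show "sparse k r {..<k} {..<n} S"
    unfolding sparse_def
  proof (intro conjI allI impI ballI)
    fix T assume T: "T \<subseteq> {..<k}" "card T < k"
    have finT: "finite T" using T(1) finite_subset by blast
    define A where "A = {v \<in> {..<n}. S v \<subseteq> T}"
    define B where "B = A \<inter> {..<f}"
    have full: "v < f + c" if "v \<in> A" for v
    proof (rule ccontr)
      assume "\<not> v < f + c"
      then have "{..<k} \<subseteq> T" using that by (simp add: A_def S_def)
      then show False using T by (metis card_lessThan less_irrefl subset_antisym)
    qed
    have one: "v = w" if "v \<in> A - {..<f}" "w \<in> A - {..<f}" for v w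
    proof (rule ccontr)
      assume "v \<noteq> w"
      have v: "f \<le> v" "v < f + c" and w: "f \<le> w" "w < f + c" using that full by auto
      have "v - f < r" "w - f < r" "v - f \<noteq> w - f"
        using v w \<open>v \<noteq> w\<close> by (auto simp: c_def split: if_splits)
      then have "(\<lambda>i. i * r + (v - f)) ` {..<f} \<inter> (\<lambda>i. i * r + (w - f)) ` {..<f} = {}"
        by (auto) (metis mod_less mod_mult_self3)
      then have "{..<k} \<subseteq> S v \<union> S w" using v w by (auto simp: S_def)
      also have "\<dots> \<subseteq> T" using that by (auto simp: A_def)
      finally show False using T by (metis card_lessThan less_irrefl subset_antisym)
    qed
    have cardB: "card (\<Union>v\<in>B. {v * r..<v * r + r}) = r * card B"
    proof -
      have "card (\<Union>v\<in>B. {v * r..<v * r + r}) = (\<Sum>v\<in>B. card {v * r..<v * r + r})"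
        using disj by (intro card_UN_disjoint) (auto simp: B_def)
      then show ?thesis by (simp add: mult.commute)
    qed
    have BT: "(\<Union>v\<in>B. {v * r..<v * r + r}) \<subseteq> T" by (auto simp: B_def A_def S_def)
    show "r * card {v \<in> {..<n}. S v \<subseteq> T} \<le> card T"
    proof (cases "A \<subseteq> {..<f}")
      case True
      then have "A = B" by (auto simp: B_def)
      then show ?thesis using card_mono[OF finT BT] cardB by (simp add: A_def)
    next
      case False
      then obtain e where e: "e \<in> A" "f \<le> e" by (meson lessThan_iff not_le subsetI)
      have AB: "A = insert e B"
      proof -
        have "x = e" if "x \<in> A" "\<not> x < f" for x using one[of x e] e that by simp
        then show ?thesis using e(1) by (auto simp: B_def)
      qed
      have finB: "finite B" by (simp add: B_def)
      have cA: "card A = card B + 1"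
      proof -
        have "e \<notin> B" using e by (simp add: B_def)
        then show ?thesis using finB by (simp add: AB)
      qed
      have ec: "e < f + c" using full e by blast
      have s: "\<not> r dvd k" using ec e(2) by (auto simp: c_def split: if_splits)
      have "{..<k} - T \<subseteq> (\<lambda>i. i * r + (e - f)) ` ({..<f} - B)"
      proof
        fix x assume x: "x \<in> {..<k} - T"
        have "S e = {..<k} - (\<lambda>i. i * r + (e - f)) ` {..<f}" using e ec by (simp add: S_def)
        moreover have "x \<notin> S e" using e(1) x unfolding A_def by blast
        ultimately obtain i where i: "i < f" "x = i * r + (e - f)" using x by blast
        have "e - f < r" using e ec by (auto simp: c_def split: if_splits)
        then have "x \<in> {i * r..<i * r + r}" using i(2) by simp
        then have "i \<notin> B" using BT x by blast
        then show "x \<in> (\<lambda>i. i * r + (e - f)) ` ({..<f} - B)" using i by blast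
      qed
      then have "card ({..<k} - T) \<le> card ((\<lambda>i. i * r + (e - f)) ` ({..<f} - B))"
        by (intro card_mono) auto
      also have "\<dots> \<le> card ({..<f} - B)" by (rule card_image_le) simp
      also have "\<dots> = f - card B" using finB by (subst card_Diff_subset) (auto simp: B_def)
      finally have le: "k - card T \<le> f - card B" using T(1) finT by (simp add: card_Diff_subset)
      moreover have "0 < k - card T" using T(2) by simp
      ultimately have "card B < f" by linarith
      then obtain u where u: "f = card B + 1 + u" by (auto dest: less_imp_Suc_add)
      \<comment> \<open>Now \<open>card T >= k - (1 + u)\<close>, and a remainder
        \<open>k mod r >= 1\<close> lifts this to \<open>r * (card B + 1)\<close>. With remainder 0
        and \<open>u = 0\<close> the estimate would be one short; therefore \<open>c\<close> is 0
        when \<open>r\<close> divides \<open>k\<close>.\<close>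
      have "u \<le> u * r" using r by simp
      moreover have "k mod r \<ge> 1" using s by (simp add: dvd_eq_mod_eq_0)
      moreover have "k = r * card B + r + u * r + k mod r" using k u by (simp add: algebra_simps)
      ultimately have "r * card B + r \<le> card T" using le u by linarith
      then show ?thesis using cA by (simp add: A_def)
    qed
  qed (use SP in blast)
  assume n: "f + c \<le> n"
  have "(\<Sum>v<n. card (S v)) = (\<Sum>v<f. card (S v)) + (\<Sum>v\<in>{f..<f + c}. card (S v)) + (\<Sum>v\<in>{f + c..<n}. card (S v))"
    using n by (simp add: lessThan_atLeast0 sum.atLeastLessThan_concat)
  also have "(\<Sum>v<f. card (S v)) = f * r" by (simp add: S_def)
  also have "(\<Sum>v\<in>{f..<f + c}. card (S v)) = (\<Sum>v\<in>{f..<f + c}. k - f)"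
  proof (rule sum.cong)
    fix v assume v: "v \<in> {f..<f + c}"
    then have vr: "v - f < r" by (auto simp: c_def split: if_splits)
    have "card (S v) = card ({..<k} - (\<lambda>i. i * r + (v - f)) ` {..<f})" using v by (simp add: S_def)
    also have "\<dots> = k - card ((\<lambda>i. i * r + (v - f)) ` {..<f})"
      using ub[OF _ vr] k by (subst card_Diff_subset) fastforce+
    also have "card ((\<lambda>i. i * r + (v - f)) ` {..<f}) = f"
      using r by (subst card_image) (auto simp: inj_on_def)
    finally show "card (S v) = k - f" .
  qed simp
  also have "(\<Sum>v\<in>{f + c..<n}. card (S v)) = (n - (f + c)) * k" by (simp add: S_def)
  finally show "(\<Sum>v<n. card (S v)) = f * r + c * (k - f) + (n - (f + c)) * k" by simp
qed

subsection \<open>The values of \<^term>\<open>mcbc_min\<close>\<close>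

text \<open>Crude bounds that serve to derive \<open>k <= n * r\<close>, that is, the existence of
  requests, from a lower limit on \<open>n\<close>.\<close>

lemma le_choose_pred:
  assumes "0 < k" "k \<le> m"
  shows "(k - 1) * (m - k + 1) + 1 \<le> m choose (k - 1)" and "k \<le> m choose (k - 1)"
proof -
  show 1: "(k - 1) * (m - k + 1) + 1 \<le> m choose (k - 1)"
    using binomial_ge_mult[of "m - k + 1" "k - 1"] assms by simp
  have "(k - 1) * 1 \<le> (k - 1) * (m - k + 1)" by (intro mult_le_mono2) simp
  then show "k \<le> m choose (k - 1)" using 1 by linarith
qed

lemma mcbc_min_large:
  assumes n: "0 < n" and k: "0 < k" "k \<le> m" and r: "0 < r"
    and large: "((k - 1) div r) * (m choose (k - 1)) \<le> n"
  shows "int (mcbc_min n k m r) = int (k * n) - int (((k - 1) div r) * (m choose (k - 1)))"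
proof (rule antisym)
  let ?M = "((k - 1) div r) * (m choose (k - 1))"
  have "mcbc_min (0 + ?M + (n - ?M)) k m r \<le> (k - 2) * 0 + (k - 1) * ?M + k * (n - ?M)"
    using mcbc_min_layers_le[of "{..<m}" m k r "{}" ?M "n - ?M"] k r by simp
  also have "0 + ?M + (n - ?M) = n" using large by simp
  finally have "mcbc_min n k m r + ?M \<le> (k - 1) * ?M + k * (n - ?M) + ?M" by simp
  also have "\<dots> = k * n"
  proof -
    obtain t where "n = ?M + t" using large by (metis le_iff_add)
    moreover have "(k - 1) * ?M + ?M = k * ?M" using k by (cases k) simp_all
    ultimately show ?thesis by (simp add: distrib_left)
  qed
  finally show "int (mcbc_min n k m r) \<le> int (k * n) - int ?M" by linarith
  \<comment> \<open>If the floor is 0 then \<open>k <= r\<close>; otherwise \<open>n\<close> is at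
    least \<open>m choose (k - 1)\<close> and hence at least \<open>k\<close>.\<close>
  have "k \<le> n * r"
  proof (cases "(k - 1) div r = 0")
    case True
    then have "k \<le> 1 * r" using k r by (auto simp: div_eq_0_iff)
    also have "\<dots> \<le> n * r" using n by (intro mult_le_mono1) simp
    finally show ?thesis .
  next
    case False
    then have "1 * (m choose (k - 1)) \<le> ?M" by (intro mult_le_mono1) simp
    then have "k \<le> n" using le_choose_pred(2)[OF k] large by linarith
    also have "n * 1 \<le> n * r" using r by (intro mult_le_mono2) simp
    finally show ?thesis by simp
  qed
  then show "int (k * n) - int ?M \<le> int (mcbc_min n k m r)"
    using mcbc_min_ge(1)[OF _ k r] by simp
qed

text \<open>The floor is 1, so distinct \<open>(k - 1)\<close>-sets do, and no item can use fewer
  than \<open>r = k - 1\<close> servers. A single item with at most \<open>k - 1\<close> copies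
  would admit no request.\<close>

lemma mcbc_min_pred_small:
  assumes k: "0 < k - 1" "k \<le> m" and n: "1 < n" "n \<le> m choose (k - 1)"
  shows "mcbc_min n k m (k - 1) = (k - 1) * n"
proof (rule antisym)
  show "mcbc_min n k m (k - 1) \<le> (k - 1) * n"
    using mcbc_min_layers_le[of "{..<m}" m k "k - 1" "{}" n 0] k n by simp
  have "k \<le> 2 * (k - 1)" using k by simp
  also have "\<dots> \<le> n * (k - 1)" using n by (intro mult_le_mono1) simp
  finally show "(k - 1) * n \<le> mcbc_min n k m (k - 1)"
    using mcbc_min_ge(3)[of k n "k - 1" m] k by simp
qed

text \<open>Replacing a \<open>(k - 1)\<close>-set by a \<open>(k - 2)\<close>-set saves one unit of
  storage and costs \<open>m - k + 1\<close> further slots, of which \<open>M - n\<close> are spare.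
  The quotient counts the affordable replacements, and the lower limit on \<open>n\<close> says that
  an optimal code supplies that many.\<close>

lemma mcbc_min_middle:
  assumes k: "k \<le> m" and r: "0 < r" "r \<le> k - 2"
  defines "M \<equiv> ((k - 1) div r) * (m choose (k - 1))"
  assumes lo: "int M - int ((m - k + 1) * max_constant_weight_code m 4 (k - 2)) \<le> int n"
    and hi: "n \<le> M"
  shows "int (mcbc_min n k m r) = int ((k - 1) * n) - (int M - int n) div int (m - k + 1)"
proof -
  define c where "c = m - k + 1"
  define B where "B = (m choose (k - 1))"
  have k3: "3 \<le> k" "0 < k" using r by auto
  obtain K where K: "K \<subseteq> {X. X \<subseteq> {..<m} \<and> card X = k - 2}"
      and cardK: "card K = max_constant_weight_code m 4 (k - 2)"
      and K1: "\<And>T. finite T \<Longrightarrow> card T = Suc (k - 2) \<Longrightarrow> card {X \<in> K. X \<subseteq> T} \<le> 1"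
    using set_family_of_code[of m "k - 2"] by blast
  have Suck: "Suc (k - 2) = k - 1" using k3 by simp
  \<comment> \<open>A packing bound: every member of \<open>K\<close> lies in \<open>c + 1\<close>
    sets of size \<open>k - 1\<close>, and no two members share one.\<close>
  have KB: "card K * (c + 1) \<le> B"
  proof -
    have c1: "m - (k - 2) = c + 1" using k k3 by (simp add: c_def)
    have "card K * (m - (k - 2)) = (\<Sum>T | T \<subseteq> {..<m} \<and> card T = Suc (k - 2). card {X \<in> K. X \<subseteq> T})"
      using sum_card_subfamily[OF _ _ _ K] k k3 by simp
    also have "\<dots> \<le> (\<Sum>T | T \<subseteq> {..<m} \<and> card T = Suc (k - 2). 1)"
      by (intro sum_mono K1) (auto intro: finite_subset[of _ "{..<m}"])
    also have "\<dots> = B"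
      using n_subsets[of "{..<m}" "k - 1"] by (simp add: B_def Suck)
    finally show ?thesis by (simp only: c1)
  qed
  have lo': "M \<le> n + c * card K"
    using lo by (simp add: cardK c_def del: of_nat_mult flip: of_nat_mult of_nat_add)
  have f: "1 \<le> (k - 1) div r" using r by (simp add: less_eq_div_iff_mult_less_eq)
  then have BM: "B \<le> M" by (simp add: M_def B_def)
  \<comment> \<open>For \<open>n <= 1\<close> it would follow that \<open>card K <= 1\<close> and
    then \<open>B <= c + 1\<close>, whereas \<open>B >= 2 * c + 1\<close>.\<close>
  have n2: "2 \<le> n"
  proof (rule ccontr)
    assume "\<not> 2 \<le> n"
    moreover have "card K + c * card K \<le> B" using KB by (simp add: mult.commute)
    ultimately have "card K \<le> 1" using BM lo' by linarith
    then have "c * card K \<le> c" by simp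
    then have "B \<le> 1 + c" using BM lo' \<open>\<not> 2 \<le> n\<close> by linarith
    moreover have "2 * c \<le> (k - 1) * c" using k3 by (intro mult_le_mono1) simp
    moreover have "1 \<le> c" by (simp add: c_def)
    ultimately show False using le_choose_pred(1)[OF k3(2) k, folded B_def c_def] by linarith
  qed
  \<comment> \<open>Floor 1 means \<open>k - 1 < 2 * r\<close>, so two items suffice. With a larger
    floor \<open>M >= 2 * B\<close>, while \<open>c * card K <= B\<close>, hence
    \<open>n >= B >= k\<close>.\<close>
  have nr: "k \<le> n * r"
  proof (cases "(k - 1) div r = 1")
    case True
    then have "k - 1 < 2 * r" using r by (metis div_less_iff_less_mult lessI numeral_2_eq_2 One_nat_def)
    also have "2 * r \<le> n * r" using n2 by simp
    finally show ?thesis by simp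
  next
    case False
    then have "2 * B \<le> M" using f unfolding M_def B_def by (intro mult_le_mono1) simp
    then have "B \<le> n" using lo' KB by (simp add: mult.commute)
    then have "k \<le> n" using le_choose_pred(2)[OF k3(2) k] by (simp add: B_def)
    also have "n * 1 \<le> n * r" using r by (intro mult_le_mono2) simp
    finally show ?thesis by simp
  qed
  define x where "x = (M - n) div c"
  have c: "1 \<le> c" by (simp add: c_def)
  have xc: "x * c \<le> M - n" by (simp add: x_def)
  have xK: "x \<le> card K"
  proof -
    have "M - n \<le> card K * c" using lo' by (simp add: mult.commute)
    then have "x \<le> card K * c div c" unfolding x_def by (rule div_le_mono)
    then show ?thesis using c by simp
  qed
  have "x \<le> n" using xK KB BM lo' by (simp add: mult.commute)
  obtain K' where K': "K' \<subseteq> K" "card K' = x" using xK by (metis obtain_subset_with_card_n)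
  have "mcbc_min (card K' + (n - x) + 0) k m r \<le> (k - 2) * card K' + (k - 1) * (n - x) + k * 0"
  proof (rule mcbc_min_layers_le[where P = "{..<m}"])
    show "K' \<subseteq> {X. X \<subseteq> {..<m} \<and> card X = k - 2}" using K' K by blast
    show "card {X \<in> K'. X \<subseteq> T} \<le> 1" if "T \<subseteq> {..<m}" "card T = k - 1" for T
    proof -
      have finT: "finite T" using that(1) finite_subset by blast
      have "card {X \<in> K'. X \<subseteq> T} \<le> card {X \<in> K. X \<subseteq> T}"
        using K'(1) finT by (intro card_mono) (auto intro: finite_subset[of _ "Pow T"])
      also have "\<dots> \<le> 1" using K1 finT that(2) Suck by simp
      finally show ?thesis .
    qed
    have "n - x + x * (c + 1) = n + x * c" using \<open>x \<le> n\<close> by simp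
    also have "\<dots> \<le> M" using xc hi by simp
    finally show "n - x + card K' * (m - k + 2) \<le> (k - 1) div r * (m choose (k - 1))"
      using K' by (simp add: c_def M_def)
  qed (use k k3 r in auto)
  also have "(k - 2) * card K' + (k - 1) * (n - x) + k * 0 = (k - 1) * n - x"
  proof -
    obtain t where t: "n = x + t" using \<open>x \<le> n\<close> by (metis le_iff_add)
    have "(k - 1) * x = (k - 2) * x + x" using Suck by (metis mult_Suc add.commute)
    then show ?thesis using t K' by (simp add: distrib_left)
  qed
  finally have "mcbc_min n k m r \<le> (k - 1) * n - x" using K' \<open>x \<le> n\<close> by simp
  moreover have "1 * x \<le> (k - 1) * n" using \<open>x \<le> n\<close> k3 by (intro mult_le_mono) auto
  ultimately have upper: "int (mcbc_min n k m r) \<le> int ((k - 1) * n) - int x" by linarith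
  have "(int ((k - 1) * n) - int (mcbc_min n k m r)) * int c \<le> int M - int n"
    using mcbc_min_ge(2)[OF nr k3(2) k r(1)] unfolding M_def c_def by linarith
  then have "(int ((k - 1) * n) - int (mcbc_min n k m r)) * int c div int c \<le> (int M - int n) div int c"
    using c by (intro zdiv_mono1) auto
  then have lower: "int ((k - 1) * n) - int (mcbc_min n k m r) \<le> (int M - int n) div int c"
    using c by simp
  have "int x = (int M - int n) div int c"
    using hi by (simp add: x_def zdiv_int of_nat_diff)
  then show ?thesis using upper lower unfolding c_def by linarith
qed

text \<open>For \<open>m = k\<close> a set of size \<open>s <= k\<close> has exactly
  \<open>k - s\<close> supersets of size \<open>k - 1\<close>, so the first bound is exact at every
  size and sizes may be mixed. Compared with \<open>k\<close> servers per item, a block saves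
  \<open>k - r\<close> and a complement saves \<open>f\<close>. The total is
  \<open>f * (k - r) + r * f = f * k\<close> if \<open>r\<close> does not divide \<open>k\<close>,
  and \<open>(f - 1) * k\<close> if it does; in the latter case
  \<open>(k - 1) div r = f - 1\<close>.\<close>

lemma mcbc_min_diagonal:
  assumes k: "0 < k" and r: "0 < r"
    and n: "r dvd k \<and> n \<ge> k div r \<or> \<not> r dvd k \<and> n \<ge> k div r + r"
  shows "int (mcbc_min n k k r) = int (k * n) - int (((k - 1) div r) * k)"
proof (rule antisym)
  define f where "f = k div r"
  define c where "c = (if r dvd k then 0 else r)"
  have fc: "f + c \<le> n" using n by (auto simp: f_def c_def)
  have fk: "f \<le> k" by (simp add: f_def)
  have "mcbc_min n k k r \<le> f * r + c * (k - f) + (n - (f + c)) * k"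
    using mcbc_min_le[OF finite_lessThan finite_lessThan sparse_blocks(1)[OF r, of k n] card_lessThan card_lessThan]
    unfolding sparse_blocks(2)[OF r fc[unfolded f_def c_def]] f_def c_def .
  moreover have "f * r + c * (k - f) + (n - (f + c)) * k + ((k - 1) div r) * k = k * n"
  proof -
    obtain t where t: "n = f + c + t" using fc by (metis le_iff_add)
    show ?thesis
    proof (cases "r dvd k")
      case True
      then obtain p where p: "k = r * p" by blast
      then obtain p' where p': "p = Suc p'" using k by (cases p) auto
      have "(k - 1) div r = p'"
        using r by (intro div_nat_eqI) (auto simp: p p')
      then show ?thesis using True t r by (simp add: c_def f_def p p' algebra_simps)
    next
      case False
      have "(k - 1) div r = f"
      proof -
        obtain s where "k = r * f + s" "s < r" "0 < s"
          using False mult_div_mod_eq[of r k] mod_less_divisor[OF r, of k]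
          by (metis dvd_eq_mod_eq_0 f_def neq0_conv)
        then show ?thesis by (intro div_nat_eqI) auto
      qed
      moreover have "f * r + r * (k - f) = r * k"
        using fk by (metis add_mult_distrib2 le_add_diff_inverse mult.commute)
      ultimately show ?thesis using False t by (simp add: c_def algebra_simps)
    qed
  qed
  ultimately have "mcbc_min n k k r + ((k - 1) div r) * k \<le> k * n" by linarith
  then show "int (mcbc_min n k k r) \<le> int (k * n) - int (((k - 1) div r) * k)" by linarith
  have "k \<le> n * r"
  proof (cases "r dvd k")
    case True
    then have "k = k div r * r" by simp
    also have "\<dots> \<le> n * r" using True n by (intro mult_le_mono1) simp
    finally show ?thesis .
  next
    case False
    then have "k div r + 1 \<le> n" using n r by auto
    then have "(k div r + 1) * r \<le> n * r" by (rule mult_le_mono1)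
    moreover have "k \<le> (k div r + 1) * r"
      using dividend_less_div_times[OF r, of k] by simp
    ultimately show ?thesis by linarith
  qed
  then show "int (k * n) - int (((k - 1) div r) * k) \<le> int (mcbc_min n k k r)"
    using mcbc_min_ge(1)[of k n r k] k r binomial_symmetric[of "k - 1" k] by simp
qed

lemma mcbc_min_affine_plane_le:
  assumes q: "primepow q" and r: "0 < r"
    and "r \<le> q \<and> k \<le> (q - r + 1) * (2 * r - 1) \<or> r = 1 \<and> k \<le> q\<^sup>2"
  shows "mcbc_min (q\<^sup>2 + q) k (q\<^sup>2) r \<le> q ^ 3 + q\<^sup>2"
proof -
  obtain L :: "((int list \<times> nat) multiset \<Rightarrow> int) ring" and K where L: "field L" and K: "K \<subseteq> carrier L" "card K = q"
    and closed: "\<And>x y. x \<in> K \<Longrightarrow> y \<in> K \<Longrightarrow> x \<oplus>\<^bsub>L\<^esub> y \<in> K" "\<And>x y. x \<in> K \<Longrightarrow> y \<in> K \<Longrightarrow> x \<otimes>\<^bsub>L\<^esub> y \<in> K"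
    using exists_field_subset_card[OF q] by metis
  interpret L: field L by fact
  have q1: "q > 1" using primepow_gt_Suc_0[OF q] by simp
  then have finK: "finite K" using K(2) by (metis card.infinite not_less_zero)
  \<comment> \<open>\<open>None\<close> is the vertical direction; the fibres of
    \<open>s x + y\<close> are the lines \<open>y = v - s x\<close>.\<close>
  define \<pi> where "\<pi> d p = (case d of None \<Rightarrow> fst p | Some s \<Rightarrow> s \<otimes>\<^bsub>L\<^esub> fst p \<oplus>\<^bsub>L\<^esub> snd p)" for d p
  have coords: "x = x' \<and> y = y'"
    if "s \<in> K" "t \<in> K" "s \<noteq> t" "x \<in> K" "y \<in> K" "x' \<in> K" "y' \<in> K"
      and eqs: "s \<otimes>\<^bsub>L\<^esub> x \<oplus>\<^bsub>L\<^esub> y = s \<otimes>\<^bsub>L\<^esub> x' \<oplus>\<^bsub>L\<^esub> y'" "t \<otimes>\<^bsub>L\<^esub> x \<oplus>\<^bsub>L\<^esub> y = t \<otimes>\<^bsub>L\<^esub> x' \<oplus>\<^bsub>L\<^esub> y'"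
    for s t x y x' y'
  proof -
    have c: "s \<in> carrier L" "t \<in> carrier L" "x \<in> carrier L" "y \<in> carrier L" "x' \<in> carrier L" "y' \<in> carrier L"
      using that K(1) by blast+
    \<comment> \<open>Subtracting the two equations eliminates \<open>y\<close> and leaves
      \<open>(s - t)(x - x') = 0\<close>.\<close>
    have "(s \<ominus>\<^bsub>L\<^esub> t) \<otimes>\<^bsub>L\<^esub> (x \<ominus>\<^bsub>L\<^esub> x')
        = (s \<otimes>\<^bsub>L\<^esub> x \<oplus>\<^bsub>L\<^esub> y \<ominus>\<^bsub>L\<^esub> (s \<otimes>\<^bsub>L\<^esub> x' \<oplus>\<^bsub>L\<^esub> y')) \<ominus>\<^bsub>L\<^esub> (t \<otimes>\<^bsub>L\<^esub> x \<oplus>\<^bsub>L\<^esub> y \<ominus>\<^bsub>L\<^esub> (t \<otimes>\<^bsub>L\<^esub> x' \<oplus>\<^bsub>L\<^esub> y'))"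
      using c by algebra
    also have "\<dots> = \<zero>\<^bsub>L\<^esub>" using c by (simp add: eqs a_minus_def L.r_neg)
    finally have "s \<ominus>\<^bsub>L\<^esub> t = \<zero>\<^bsub>L\<^esub> \<or> x \<ominus>\<^bsub>L\<^esub> x' = \<zero>\<^bsub>L\<^esub>"
      using c by (intro L.integral) auto
    then have "x = x'" using c \<open>s \<noteq> t\<close> by simp
    moreover from this have "y = y'" using eqs(1) c by (metis L.add.l_cancel L.m_closed)
    ultimately show ?thesis by simp
  qed
  interpret affine_plane q "insert None (Some ` K)" K "K \<times> K" \<pi>
  proof
    show "card (insert None (Some ` K)) = q + 1"
      using finK K(2) by (simp add: card_image)
    show "\<pi> d p \<in> K" if "d \<in> insert None (Some ` K)" "p \<in> K \<times> K" for d p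
      using that closed by (auto simp: \<pi>_def)
    show "p = p'" if dd: "d \<in> insert None (Some ` K)" "d' \<in> insert None (Some ` K)" "d \<noteq> d'"
      "p \<in> K \<times> K" "p' \<in> K \<times> K" "\<pi> d p = \<pi> d p'" "\<pi> d' p = \<pi> d' p'" for d d' p p'
    proof -
      obtain x y x' y' where p: "p = (x, y)" "p' = (x', y')" by fastforce
      have K': "x \<in> K" "y \<in> K" "x' \<in> K" "y' \<in> K" using dd p by auto
      have cancel: "p = p'" if "x = x'" "s \<in> K" "s \<otimes>\<^bsub>L\<^esub> x \<oplus>\<^bsub>L\<^esub> y = s \<otimes>\<^bsub>L\<^esub> x' \<oplus>\<^bsub>L\<^esub> y'" for s
      proof -
        have "s \<otimes>\<^bsub>L\<^esub> x' \<in> carrier L" "y \<in> carrier L" "y' \<in> carrier L"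
          using K' K(1) that(2) closed(2) by blast+
        then show ?thesis
          using L.add.l_cancel[of "s \<otimes>\<^bsub>L\<^esub> x'" y y'] that by (simp add: p)
      qed
      consider s where "s \<in> K" "d = Some s" "d' = None" | s where "s \<in> K" "d = None" "d' = Some s"
        | s t where "s \<in> K" "t \<in> K" "s \<noteq> t" "d = Some s" "d' = Some t"
        using dd(1-3) by (cases d; cases d') auto
      then show ?thesis
      proof cases
        case (1 s)
        then show ?thesis using dd(6,7) by (intro cancel) (simp_all add: \<pi>_def p)
      next
        case (2 s)
        then show ?thesis using dd(6,7) by (intro cancel) (simp_all add: \<pi>_def p)
      next
        case (3 s t)
        then show ?thesis using coords[OF 3(1-3) K'] dd(6,7) by (simp add: \<pi>_def p)
      qed
    qed
  qed (use finK K(2) q1 in \<open>auto simp: card_cartesian_product power2_eq_square\<close>)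
  let ?V = "insert None (Some ` K) \<times> K"
  have "sparse k r (K \<times> K) ?V line"
    using assms(3) sparse_lines[OF r, of k] sparse_lines_1[of k] by auto
  then have "mcbc_min (q\<^sup>2 + q) k (q\<^sup>2) r \<le> (\<Sum>l\<in>?V. card (line l))"
    using finite_D finite_K finite_P card_P card_D card_K
    by (intro mcbc_min_le) (auto simp: card_cartesian_product power2_eq_square)
  also have "\<dots> = (\<Sum>l\<in>?V. q)" using card_line by (intro sum.cong) auto
  also have "\<dots> = q ^ 3 + q\<^sup>2"
    using card_D card_K by (simp add: card_cartesian_product power2_eq_square power3_eq_cube algebra_simps)
  finally show ?thesis .
qed

text \<open>In the first case \<open>k = m\<close>, and the secant bound equals
  \<open>k * (n - k + 1) = q^2 * (q + 1)\<close>. In the second every item needs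
  \<open>min r k = q\<close> servers, which is the size of a line.\<close>

lemma mcbc_min_affine_plane_eq:
  assumes q: "primepow q" and kr: "(k, r) \<in> {(q\<^sup>2, 1), (2 * q - 1, q)}"
  shows "mcbc_min (q\<^sup>2 + q) k (q\<^sup>2) r = q ^ 3 + q\<^sup>2"
proof (rule antisym)
  have q1: "q > 1" using primepow_gt_Suc_0[OF q] by simp
  show "mcbc_min (q\<^sup>2 + q) k (q\<^sup>2) r \<le> q ^ 3 + q\<^sup>2"
    using kr q1 by (intro mcbc_min_affine_plane_le[OF q]) auto
  consider "k = q\<^sup>2" "r = 1" | "k = 2 * q - 1" "r = q" using kr by auto
  then show "q ^ 3 + q\<^sup>2 \<le> mcbc_min (q\<^sup>2 + q) k (q\<^sup>2) r"
  proof cases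
    case 1
    have "int (q\<^sup>2 * (q\<^sup>2 + q)) - int ((q\<^sup>2 - 1) * q\<^sup>2) \<le> int (mcbc_min (q\<^sup>2 + q) k (q\<^sup>2) r)"
      using mcbc_min_ge(1)[of "q\<^sup>2" "q\<^sup>2 + q" 1 "q\<^sup>2"] q1 binomial_symmetric[of "q\<^sup>2 - 1" "q\<^sup>2"] 1 by simp
    moreover have "int (q\<^sup>2 - 1) = int (q\<^sup>2) - 1" using q1 by (simp add: of_nat_diff)
    ultimately have "int (q ^ 3 + q\<^sup>2) \<le> int (mcbc_min (q\<^sup>2 + q) k (q\<^sup>2) r)"
      by (simp add: algebra_simps power2_eq_square power3_eq_cube)
    then show ?thesis by (simp only: of_nat_le_iff)
  next
    case 2
    have "2 * q \<le> q * q" using q1 by (intro mult_le_mono1) simp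
    then have km: "2 * q - 1 \<le> q\<^sup>2" unfolding power2_eq_square by linarith
    then have "2 * q - 1 \<le> (q\<^sup>2 + q) * 1" by simp
    also have "\<dots> \<le> (q\<^sup>2 + q) * q" using q1 by (intro mult_le_mono2) simp
    finally have kn: "2 * q - 1 \<le> (q\<^sup>2 + q) * q" .
    have "min q (2 * q - 1) * (q\<^sup>2 + q) \<le> mcbc_min (q\<^sup>2 + q) (2 * q - 1) (q\<^sup>2) q"
      using q1 km kn by (intro mcbc_min_ge(3)) simp_all
    moreover have "min q (2 * q - 1) = q" using q1 by simp
    ultimately show ?thesis using 2 by (simp add: algebra_simps power2_eq_square power3_eq_cube)
  qed
qed

text \<open>Differences that are subtracted from a main term are taken in the integers, where they
  are not truncated. For \<open>n = 1\<close> and \<open>r = k - 1\<close> there is no request and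
  the minimum is 0, which is why that value is claimed for \<open>1 < n\<close>.\<close>

theorem theorem3:
  fixes n k m r :: nat
  assumes "n > 0" and "k > 0" and "m > 0" and "r > 0"
    and "r \<le> k" and "k \<le> m"
  shows
    "(n \<ge> ((k - 1) div r) * (m choose (k - 1)) \<longrightarrow>
        int (mcbc_min n k m r) = int (k * n) - int (((k - 1) div r) * (m choose (k - 1))))
   \<and> (r = k \<longrightarrow> mcbc_min n k m k = k * n)
   \<and> (r = k - 1 \<longrightarrow>
        (n \<ge> (m choose (k - 1)) \<longrightarrow>
           int (mcbc_min n k m (k - 1)) = int (k * n) - int (m choose (k - 1))) \<and>
        (1 < n \<and> n < (m choose (k - 1)) \<longrightarrow>
           mcbc_min n k m (k - 1) = (k - 1) * n))
   \<and> (r \<le> k - 2 \<and>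
      int (((k - 1) div r) * (m choose (k - 1)))
        - int ((m - k + 1) * max_constant_weight_code m 4 (k - 2)) \<le> int n \<and>
      n \<le> ((k - 1) div r) * (m choose (k - 1)) \<longrightarrow>
        int (mcbc_min n k m r) =
          int ((k - 1) * n)
            - (int (((k - 1) div r) * (m choose (k - 1))) - int n) div int (m - k + 1))
   \<and> (m = k \<and> (r dvd k \<and> n \<ge> k div r \<or> \<not> r dvd k \<and> n \<ge> k div r + r) \<longrightarrow>
        int (mcbc_min n k k r) = int (k * n) - int (((k - 1) div r) * k))
   \<and> (\<forall>q::nat. primepow q \<and> n = q\<^sup>2 + q \<and> m = q\<^sup>2 \<longrightarrow>
        ((q div 2 + 1 \<le> r \<and> r \<le> q \<and> k \<le> (q - r + 1) * (2 * r - 1) \<or> r = 1 \<and> k \<le> q\<^sup>2) \<longrightarrow>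
           mcbc_min (q\<^sup>2 + q) k (q\<^sup>2) r \<le> q ^ 3 + q\<^sup>2) \<and>
        ((k, r) \<in> {(q\<^sup>2, 1), (2 * q - 1, q)} \<longrightarrow>
           mcbc_min (q\<^sup>2 + q) k (q\<^sup>2) r = q ^ 3 + q\<^sup>2))"
proof (intro conjI impI allI, goal_cases)
  case 1
  then show ?case using mcbc_min_large assms by simp
next
  case 2
  have "(k - 1) div k = 0" using assms by simp
  then have "int (mcbc_min n k m k) = int (k * n)"
    using mcbc_min_large[of n k m k] assms by simp
  then show ?case by (simp only: of_nat_eq_iff)
next
  case 3
  then have "(k - 1) div (k - 1) = 1" using assms by simp
  then show ?case using mcbc_min_large[of n k m "k - 1"] 3 assms by simp
next
  case 4
  then show ?case using mcbc_min_pred_small[of k m n] assms by simp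
next
  case 5
  then show ?case using mcbc_min_middle[of k m r n] assms by simp
next
  case 6
  then show ?case using mcbc_min_diagonal[of k r n] assms by simp
next
  case (7 q)
  then show ?case using mcbc_min_affine_plane_le[of q r k] assms by auto
next
  case (8 q)
  then show ?case using mcbc_min_affine_plane_eq[of q k r] by simp
qed

end
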